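(* Let $g=(g_1,g_2)\in X$, $f\in L^2(\Omega;\mathbb{R}^d)$, $q\in L^2(\partial_N\Omega;\mathbb{R}^d)$ and $\zeta\in L^\infty(\Gamma)$ with $\zeta\ge 0$. Let $u_1^0\in V_1(g_1)$ and $u_2^0\in V_2(g_2)$, and let $u^m=(u_1^m,u_2^m)\in V(g)$, $m=1,2,\dots$, be a sequence generated by the Gauss-Seidel type scheme, i.e. for every $m\ge 1$, $$a_1(u_1^m,v_1)+a_\Gamma(u_1^m,v_1)=a_\Gamma(u_2^{m-1},v_1)+l_1(v_1)\quad\text{for all }v_1\in V_1,$$ $$a_2(u_2^m,v_2)+a_\Gamma(u_2^m,v_2)=a_\Gamma(u_1^m,v_2)+l_2(v_2)\quad\text{for all }v_2\in V_2.$$ Then $$E((u_1^{m-1},u_2^{m-1}))\ \ge\ E((u_1^m,u_2^{m-1}))\ \ge\ E((u_1^m,u_2^m))\qquad(m=1,2,\dots),$$ where $E(u):=\tfrac12 a_0(u,u)-l_0(u)$.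
   Context: Domains. $d\in\{2,3\}$; $\Omega\subset\mathbb{R}^d$ is a bounded Lipschitz domain with $\Omega\setminus\Gamma=\Omega_1\cup\Omega_2$, $\Omega_1\cap\Omega_2=\emptyset$, where $\Gamma$ is a Lipschitz surface which is the common boundary of the two disjoint Lipschitz domains $\Omega_1,\Omega_2$. The boundary decomposes as $\partial\Omega=\partial_D\Omega\cup\overline{\partial_N\Omega}$ with $\partial_D\Omega\cap\overline{\partial_N\Omega}=\emptyset$ and $\mathcal{H}^{d-1}(\overline{\partial_N\Omega}\setminus\partial_N\Omega)=0$, where $\partial_D\Omega,\partial_N\Omega$ are relatively open in $\partial\Omega$ and $\mathcal{H}^{d-1}$ is the $(d-1)$-dimensional Hausdorff measure. Put $\partial_D\Omega_i:=\partial_D\Omega\cap\partial\Omega_i$, $\partial_N\Omega_i:=\partial_N\Omega\cap\partial\Omega_i$ $(i=1,2)$. $\partial_D\Omega$ is nonempty and $\mathcal{H}^{d-1}(\partial_D\Omega_1)>0$. Elasticity. $e(u)$ is the symmetric gradient, $e_{kl}(u)=\frac12(\partial_k u_l+\partial_l u_k)$, and $\sigma(u)=\mathcal{C}e(u)$, $\sigma_{kl}(u)=\sum_{m,n}c_{klmn}e_{mn}(u)$. The elasticity tensor $\mathcal{C}=(c_{klmn})\in L^\infty(\Omega;\mathbb{R}^{d\times d\times d\times d})$ has the symmetries $c_{klmn}=c_{mnkl}=c_{lkmn}$, and there is $c_*>0$ with $\sum c_{klmn}(x)\xi_{kl}\xi_{mn}\ge c_*|\xi|^2$ for a.e. $x\in\Omega$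 and all symmetric $\xi\in\mathbb{R}^{d\times d}$. Here $\xi:\eta=\sum_{k,l}\xi_{kl}\eta_{kl}$, $|\xi|=\sqrt{\xi:\xi}$. Spaces. $X_i:=H^1(\Omega_i;\mathbb{R}^d)$, $V_i:=\{u_i\in X_i: u_i|_{\partial_D\Omega_i}=0\}$, $V_i(g_i):=V_i+g_i$; $X:=H^1(\Omega\setminus\Gamma;\mathbb{R}^d)\cong X_1\times X_2$, $V:=\{u\in X:u|_{\partial_D\Omega}=0\}\cong V_1\times V_2$, $V(g):=V+g\cong V_1(g_1)\times V_2(g_2)$. For $u\in X$ write $u=(u_1,u_2)$ with $u_i=u|_{\Omega_i}$, and $[u]:=u_2-u_1$ on $\Gamma$ (traces). Forms. $a_i(u_i,v_i):=\int_{\Omega_i}\sigma(u_i):e(v_i)\,dx$; $a_\Gamma(u,v):=\int_\Gamma\zeta\,u\cdot v\,ds$ (arguments are replaced by their traces on $\Gamma$); $l_i(v_i):=\int_{\Omega_i}f\cdot v_i\,dx+\int_{\partial_N\Omega_i}q\cdot v_i\,ds$; $a_0(u,v):=a_1(u_1,v_1)+a_2(u_2,v_2)+a_\Gamma([u],[v])$; $l_0(v):=l_1(v_1)+l_2(v_2)$. *)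

theory Defs
  imports "HOL-Analysis.Analysis"
begin

section \<open>Hausdorff and surface measure\<close>

text \<open>
  Coverings by bounded sets only: \<^const>\<open>diameter\<close> of an unbounded set is \<open>0\<close> in the library.
  The factor \<^term>\<open>unit_ball_vol s\<close> makes the measure agree with the
  surface area when \<open>s\<close> is an integer.
\<close>

definition hausdorff_outer :: "real \<Rightarrow> 'a::metric_space set \<Rightarrow> ennreal" where
  "hausdorff_outer s A =
     (SUP \<delta>\<in>{0<..}. INF C\<in>{C :: nat \<Rightarrow> 'a set. A \<subseteq> (\<Union>i. C i) \<and> (\<forall>i. bounded (C i) \<and> diameter (C i) \<le> \<delta>)}.
        (\<Sum>i. ennreal (unit_ball_vol s * (diameter (C i) / 2) powr s)))"

definition hausdorff_measure :: "real \<Rightarrow> 'a::metric_space measure" where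
  "hausdorff_measure s = measure_of UNIV (sets borel) (hausdorff_outer s)"

definition surface_measure :: "(real^'n) set \<Rightarrow> (real^'n) measure" where
  "surface_measure S = restrict_space (completion (hausdorff_measure (real CARD('n) - 1))) S"


section \<open>Lebesgue spaces\<close>

text \<open>The elements are functions, not equivalence classes; their values off the space of \<open>M\<close> are irrelevant.\<close>

definition L2 :: "'a measure \<Rightarrow> ('a \<Rightarrow> 'b::euclidean_space) set" where
  "L2 M = {f \<in> borel_measurable M. integrable M (\<lambda>x. (norm (f x))\<^sup>2)}"

definition Linf :: "'a measure \<Rightarrow> ('a \<Rightarrow> real) set" where
  "Linf M = {f \<in> borel_measurable M. \<exists>B. AE x in M. \<bar>f x\<bar> \<le> B}"


section \<open>Sobolev space and trace\<close>

definition partial :: "'n \<Rightarrow> (real^'n \<Rightarrow> real) \<Rightarrow> real^'n \<Rightarrow> real" where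
  "partial k f x = frechet_derivative f (at x) (axis k 1)"

primrec Ck :: "nat \<Rightarrow> (real^'n \<Rightarrow> real) \<Rightarrow> bool" where
  "Ck 0 f \<longleftrightarrow> continuous_on UNIV f"
| "Ck (Suc m) f \<longleftrightarrow> (\<forall>x. f differentiable (at x)) \<and> (\<forall>k. Ck m (partial k f))"

definition smooth :: "(real^'n \<Rightarrow> real) \<Rightarrow> bool" where
  "smooth f \<longleftrightarrow> (\<forall>m. Ck m f)"

definition test_functions :: "(real^'n) set \<Rightarrow> (real^'n \<Rightarrow> real) set" where
  "test_functions \<Omega> =
     {\<phi>. smooth \<phi> \<and> compact (closure {x. \<phi> x \<noteq> 0}) \<and> closure {x. \<phi> x \<noteq> 0} \<subseteq> \<Omega>}"

definition has_weak_partial ::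
    "(real^'n) set \<Rightarrow> 'n \<Rightarrow> (real^'n \<Rightarrow> real) \<Rightarrow> (real^'n \<Rightarrow> real) \<Rightarrow> bool" where
  "has_weak_partial \<Omega> k w D \<longleftrightarrow>
     (\<forall>\<phi>\<in>test_functions \<Omega>.
        (LINT x|lebesgue_on \<Omega>. w x * partial k \<phi> x) = - (LINT x|lebesgue_on \<Omega>. D x * \<phi> x))"

definition H1 :: "(real^'n) set \<Rightarrow> (real^'n \<Rightarrow> real) set" where
  "H1 \<Omega> = {w \<in> L2 (lebesgue_on \<Omega>). \<forall>k. \<exists>D \<in> L2 (lebesgue_on \<Omega>). has_weak_partial \<Omega> k w D}"

definition weak_partial :: "(real^'n) set \<Rightarrow> 'n \<Rightarrow> (real^'n \<Rightarrow> real) \<Rightarrow> real^'n \<Rightarrow> real" where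
  "weak_partial \<Omega> k w = (SOME D. D \<in> L2 (lebesgue_on \<Omega>) \<and> has_weak_partial \<Omega> k w D)"

text \<open>
  The graph of the trace: the closure, in \<open>H\<^sup>1(\<Omega>) \<times> L\<^sup>2(\<partial>\<Omega>)\<close>, of the graph of the restriction
  map \<open>\<phi> \<mapsto> \<phi>|\<partial>\<Omega>\<close> on smooth functions.
\<close>

definition has_trace :: "(real^'n) set \<Rightarrow> (real^'n \<Rightarrow> real) \<Rightarrow> (real^'n \<Rightarrow> real) \<Rightarrow> bool" where
  "has_trace \<Omega> w g \<longleftrightarrow>
     w \<in> H1 \<Omega> \<and> g \<in> L2 (surface_measure (frontier \<Omega>)) \<and>
     (\<exists>\<phi> :: nat \<Rightarrow> real^'n \<Rightarrow> real.
        (\<forall>j. smooth (\<phi> j)) \<and>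
        (\<lambda>j. \<integral>\<^sup>+x. ennreal ((\<phi> j x - w x)\<^sup>2) \<partial>lebesgue_on \<Omega>) \<longlonglongrightarrow> 0 \<and>
        (\<forall>k. (\<lambda>j. \<integral>\<^sup>+x. ennreal ((partial k (\<phi> j) x - weak_partial \<Omega> k w x)\<^sup>2) \<partial>lebesgue_on \<Omega>) \<longlonglongrightarrow> 0) \<and>
        (\<lambda>j. \<integral>\<^sup>+x. ennreal ((\<phi> j x - g x)\<^sup>2) \<partial>surface_measure (frontier \<Omega>)) \<longlonglongrightarrow> 0)"

text \<open>
  On a bounded Lipschitz domain every function in \<open>H\<^sup>1\<close> has a trace, unique up to null sets (trace
  theorem), so the last condition determines \<open>T\<close> up to null sets. It is conditional only so that
  such a \<open>T\<close> exists for every \<open>\<Omega>\<close>.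
\<close>

definition trace_operator ::
    "(real^'n) set \<Rightarrow> ((real^'n \<Rightarrow> real) \<Rightarrow> (real^'n \<Rightarrow> real)) \<Rightarrow> bool" where
  "trace_operator \<Omega> T \<longleftrightarrow>
     (\<forall>w\<in>H1 \<Omega>. T w \<in> L2 (surface_measure (frontier \<Omega>))) \<and>
     (\<forall>v\<in>H1 \<Omega>. \<forall>w\<in>H1 \<Omega>. \<forall>a b. AE x in surface_measure (frontier \<Omega>).
         T (\<lambda>y. a * v y + b * w y) x = a * T v x + b * T w x) \<and>
     (\<forall>w\<in>H1 \<Omega>. (\<exists>g. has_trace \<Omega> w g) \<longrightarrow> has_trace \<Omega> w (T w))"

definition boundary_trace :: "(real^'n) set \<Rightarrow> (real^'n \<Rightarrow> real) \<Rightarrow> real^'n \<Rightarrow> real" where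
  "boundary_trace \<Omega> = (SOME T. trace_operator \<Omega> T)"

definition H1_vec :: "(real^'n) set \<Rightarrow> (real^'n \<Rightarrow> real^'n) set" where
  "H1_vec \<Omega> = {u. \<forall>k. (\<lambda>x. u x $ k) \<in> H1 \<Omega>}"

definition trace_vec :: "(real^'n) set \<Rightarrow> (real^'n \<Rightarrow> real^'n) \<Rightarrow> real^'n \<Rightarrow> real^'n" where
  "trace_vec \<Omega> u x = (\<chi> k. boundary_trace \<Omega> (\<lambda>y. u y $ k) x)"


section \<open>Geometry\<close>

definition lipschitz_domain :: "(real^'n) set \<Rightarrow> bool" where
  "lipschitz_domain \<Omega> \<longleftrightarrow>
     open \<Omega> \<and> connected \<Omega> \<and> \<Omega> \<noteq> {} \<and>
     (\<forall>p\<in>frontier \<Omega>. \<exists>r>0. \<exists>e \<gamma> L. norm e = 1 \<and> L-lipschitz_on {y. y \<bullet> e = 0} \<gamma> \<and>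
        (\<forall>x\<in>ball p r. x \<in> \<Omega> \<longleftrightarrow> \<gamma> (x - (x \<bullet> e) *\<^sub>R e) < x \<bullet> e))"

text \<open>
  Locally bi-Lipschitz to a relatively open subset of a half-space in a hyperplane, so the surface
  may or may not contain (parts of) its edge.
\<close>

definition lipschitz_surface :: "(real^'n) set \<Rightarrow> bool" where
  "lipschitz_surface S \<longleftrightarrow>
     (\<forall>x\<in>S. \<exists>U V (h :: real^'n \<Rightarrow> real^'n) e e' L. open U \<and> x \<in> U \<and> norm e = 1 \<and> norm e' = 1 \<and> e \<bullet> e' = 0 \<and>
        openin (top_of_set {y. y \<bullet> e = 0 \<and> 0 \<le> y \<bullet> e'}) V \<and> bij_betw h V (S \<inter> U) \<and> L > 0 \<and>
        (\<forall>y\<in>V. \<forall>z\<in>V. dist y z / L \<le> dist (h y) (h z) \<and> dist (h y) (h z) \<le> L * dist y z))"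

text \<open>
  Together with \<open>\<Omega> - \<Gamma> = \<Omega>\<^sub>1 \<union> \<Omega>\<^sub>2\<close>, the inclusion \<open>\<Gamma> \<subseteq> \<partial>\<Omega>\<^sub>1 \<inter> \<partial>\<Omega>\<^sub>2\<close> yields
  \<open>\<Gamma> \<inter> \<Omega> = \<partial>\<Omega>\<^sub>1 \<inter> \<Omega> = \<partial>\<Omega>\<^sub>2 \<inter> \<Omega>\<close>; whether \<open>\<Gamma>\<close> contains points of \<open>\<partial>\<Omega>\<close> is left open.
\<close>

definition geometry ::
    "(real^'n) set \<Rightarrow> (real^'n) set \<Rightarrow> (real^'n) set \<Rightarrow> (real^'n) set \<Rightarrow> (real^'n) set \<Rightarrow> (real^'n) set \<Rightarrow> bool" where
  "geometry \<Omega> \<Omega>1 \<Omega>2 \<Gamma> D N \<longleftrightarrow>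
     lipschitz_domain \<Omega> \<and> bounded \<Omega> \<and> lipschitz_domain \<Omega>1 \<and> lipschitz_domain \<Omega>2 \<and>
     \<Omega> - \<Gamma> = \<Omega>1 \<union> \<Omega>2 \<and> \<Omega>1 \<inter> \<Omega>2 = {} \<and>
     lipschitz_surface \<Gamma> \<and> \<Gamma> \<subseteq> frontier \<Omega>1 \<inter> frontier \<Omega>2 \<and>
     openin (top_of_set (frontier \<Omega>)) D \<and> openin (top_of_set (frontier \<Omega>)) N \<and>
     frontier \<Omega> = D \<union> closure N \<and> D \<inter> closure N = {} \<and>
     emeasure (hausdorff_measure (real CARD('n) - 1)) (closure N - N) = 0 \<and>
     D \<noteq> {} \<and>
     emeasure (hausdorff_measure (real CARD('n) - 1)) (D \<inter> frontier \<Omega>1) > 0"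


section \<open>Elasticity\<close>

type_synonym 'n tensor = "'n \<Rightarrow> 'n \<Rightarrow> 'n \<Rightarrow> 'n \<Rightarrow> real^'n \<Rightarrow> real"

definition tensor_app :: "'n tensor \<Rightarrow> real^'n \<Rightarrow> real^'n^'n \<Rightarrow> real^'n^'n" where
  "tensor_app c x \<xi> = (\<chi> k l. \<Sum>m\<in>UNIV. \<Sum>n\<in>UNIV. c k l m n x * \<xi> $ m $ n)"

text \<open>
  On \<^typ>\<open>real^'n^'n\<close> the inner product and the norm are the Frobenius ones,
  \<open>\<xi> : \<eta>\<close> and \<open>|\<xi>|\<close>.
\<close>

definition elasticity_tensor :: "(real^'n) set \<Rightarrow> 'n tensor \<Rightarrow> bool" where
  "elasticity_tensor \<Omega> c \<longleftrightarrow>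
     (\<forall>k l m n. c k l m n \<in> Linf (lebesgue_on \<Omega>)) \<and>
     (\<forall>k l m n. AE x in lebesgue_on \<Omega>. c k l m n x = c m n k l x \<and> c k l m n x = c l k m n x) \<and>
     (\<exists>c0>0. AE x in lebesgue_on \<Omega>. \<forall>\<xi>. transpose \<xi> = \<xi> \<longrightarrow> tensor_app c x \<xi> \<bullet> \<xi> \<ge> c0 * (norm \<xi>)\<^sup>2)"

definition strain :: "(real^'n) set \<Rightarrow> (real^'n \<Rightarrow> real^'n) \<Rightarrow> real^'n \<Rightarrow> real^'n^'n" where
  "strain \<Omega> u x =
     (\<chi> k l. (weak_partial \<Omega> k (\<lambda>y. u y $ l) x + weak_partial \<Omega> l (\<lambda>y. u y $ k) x) / 2)"

definition stress :: "'n tensor \<Rightarrow> (real^'n) set \<Rightarrow> (real^'n \<Rightarrow> real^'n) \<Rightarrow> real^'n \<Rightarrow> real^'n^'n" where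
  "stress c \<Omega> u x = tensor_app c x (strain \<Omega> u x)"

definition V0 :: "(real^'n) set \<Rightarrow> (real^'n) set \<Rightarrow> (real^'n \<Rightarrow> real^'n) set" where
  "V0 D \<Omega> = {u \<in> H1_vec \<Omega>. AE x in surface_measure (D \<inter> frontier \<Omega>). trace_vec \<Omega> u x = 0}"

definition V_affine ::
    "(real^'n) set \<Rightarrow> (real^'n) set \<Rightarrow> (real^'n \<Rightarrow> real^'n) \<Rightarrow> (real^'n \<Rightarrow> real^'n) set" where
  "V_affine D \<Omega> g = {\<lambda>x. v x + g x |v. v \<in> V0 D \<Omega>}"

definition bulk_form ::
    "'n tensor \<Rightarrow> (real^'n) set \<Rightarrow> (real^'n \<Rightarrow> real^'n) \<Rightarrow> (real^'n \<Rightarrow> real^'n) \<Rightarrow> real" where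
  "bulk_form c \<Omega> u v = (LINT x|lebesgue_on \<Omega>. stress c \<Omega> u x \<bullet> strain \<Omega> v x)"

text \<open>The arguments \<open>p\<close> and \<open>r\<close> are functions on \<open>\<Gamma>\<close>: traces taken from one of the two sides, or jumps.\<close>

definition interface_form ::
    "(real^'n \<Rightarrow> real) \<Rightarrow> (real^'n) set \<Rightarrow> (real^'n \<Rightarrow> real^'n) \<Rightarrow> (real^'n \<Rightarrow> real^'n) \<Rightarrow> real" where
  "interface_form \<zeta> \<Gamma> p r = (LINT x|surface_measure \<Gamma>. \<zeta> x * (p x \<bullet> r x))"

definition load_form ::
    "(real^'n \<Rightarrow> real^'n) \<Rightarrow> (real^'n \<Rightarrow> real^'n) \<Rightarrow> (real^'n) set \<Rightarrow> (real^'n) set \<Rightarrow> (real^'n \<Rightarrow> real^'n) \<Rightarrow> real" where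
  "load_form f q N \<Omega> v =
     (LINT x|lebesgue_on \<Omega>. f x \<bullet> v x) + (LINT x|surface_measure (N \<inter> frontier \<Omega>). q x \<bullet> trace_vec \<Omega> v x)"

text \<open>
  Elements of \<open>H\<^sup>1(\<Omega> - \<Gamma>) \<cong> H\<^sup>1(\<Omega>\<^sub>1) \<times> H\<^sup>1(\<Omega>\<^sub>2)\<close> are represented as pairs.
\<close>

definition jump ::
    "(real^'n) set \<Rightarrow> (real^'n) set \<Rightarrow> (real^'n \<Rightarrow> real^'n) \<times> (real^'n \<Rightarrow> real^'n) \<Rightarrow> real^'n \<Rightarrow> real^'n" where
  "jump \<Omega>1 \<Omega>2 u x = trace_vec \<Omega>2 (snd u) x - trace_vec \<Omega>1 (fst u) x"

definition total_form ::
    "'n tensor \<Rightarrow> (real^'n \<Rightarrow> real) \<Rightarrow> (real^'n) set \<Rightarrow> (real^'n) set \<Rightarrow> (real^'n) set \<Rightarrow>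
     (real^'n \<Rightarrow> real^'n) \<times> (real^'n \<Rightarrow> real^'n) \<Rightarrow> (real^'n \<Rightarrow> real^'n) \<times> (real^'n \<Rightarrow> real^'n) \<Rightarrow> real" where
  "total_form c \<zeta> \<Omega>1 \<Omega>2 \<Gamma> u v =
     bulk_form c \<Omega>1 (fst u) (fst v) + bulk_form c \<Omega>2 (snd u) (snd v)
     + interface_form \<zeta> \<Gamma> (jump \<Omega>1 \<Omega>2 u) (jump \<Omega>1 \<Omega>2 v)"

definition total_load ::
    "(real^'n \<Rightarrow> real^'n) \<Rightarrow> (real^'n \<Rightarrow> real^'n) \<Rightarrow> (real^'n) set \<Rightarrow> (real^'n) set \<Rightarrow> (real^'n) set \<Rightarrow>
     (real^'n \<Rightarrow> real^'n) \<times> (real^'n \<Rightarrow> real^'n) \<Rightarrow> real" where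
  "total_load f q N \<Omega>1 \<Omega>2 v = load_form f q N \<Omega>1 (fst v) + load_form f q N \<Omega>2 (snd v)"

definition energy ::
    "'n tensor \<Rightarrow> (real^'n \<Rightarrow> real) \<Rightarrow> (real^'n \<Rightarrow> real^'n) \<Rightarrow> (real^'n \<Rightarrow> real^'n) \<Rightarrow>
     (real^'n) set \<Rightarrow> (real^'n) set \<Rightarrow> (real^'n) set \<Rightarrow> (real^'n) set \<Rightarrow>
     (real^'n \<Rightarrow> real^'n) \<times> (real^'n \<Rightarrow> real^'n) \<Rightarrow> real" where
  "energy c \<zeta> f q N \<Omega>1 \<Omega>2 \<Gamma> u =
     1 / 2 * total_form c \<zeta> \<Omega>1 \<Omega>2 \<Gamma> u u - total_load f q N \<Omega>1 \<Omega>2 u"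

end

theory Submission
  imports Defs "HOL-Real_Asymp.Real_Asymp" "HOL-Library.Function_Algebras"
begin

text \<open>
  Each half step of the scheme solves the Euler--Lagrange equation of the energy in one component,
  the other being frozen. Writing the competitor as \<open>w = u + v\<close> with \<open>v \<in> V\<^sub>i\<close>, the energy difference is
  the Euler--Lagrange residual at \<open>v\<close>, which vanishes, plus \<open>(a\<^sub>i(v, v) + a\<^sub>\<Gamma>(v, v)) / 2 \<ge> 0\<close>.

  The forms are built from chosen representatives, so their bilinearity has to be earned. For weak
  derivatives it follows from the fundamental lemma of the calculus of variations. For traces it
  needs the existence of some trace operator, which a Hamel basis provides without the trace
  theorem: the graph of the trace is a linear relation, and every linear relation has a linear
  selection. Finally, \<open>\<Gamma>\<close> must be Borel for traces on \<open>\<partial>\<Omega>\<^sub>i\<close> to restrict to it.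
\<close>

section \<open>Smooth bump functions on boxes\<close>

text \<open>The fundamental lemma needs explicit members of \<open>test_functions\<close>. As
  \<open>smooth\<close> is an iterated condition on partial derivatives, the bumps are taken from a
  class of functions closed under differentiation, which makes smoothness an induction without any
  estimates.

  \<open>trace_operator\<close> asks for square integrability and linearity on the whole of
  \<open>H1\<close>, but for agreement with \<open>has_trace\<close> only where a trace exists. A
  \<open>SOME\<close> over it means something only once one operator meets all three demands, so the
  linear selection has to be defined on functions with and without a trace, and has to take its
  values among genuine traces everywhere in order to stay in \<open>L2\<close>.

  The components interact only through half the integral of \<zeta> times the squared jump. With one
  trace \<open>p\<close> frozen, perturbing the other trace \<open>t\<close> by \<open>s\<close>
  yields the cross term \<zeta> (t - p) . s, which is the coupling in the scheme, and a nonnegative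
  rest. Up to the sign of the jump, both half steps are therefore the same minimization, and one
  lemma with a frozen trace serves both.\<close>

definition flat :: "nat \<Rightarrow> real \<Rightarrow> real" where
  "flat n t = (if t > 0 then exp (- 1 / t) / t ^ n else 0)"

lemma flat_tendsto_0: "(flat n \<longlongrightarrow> 0) (at 0)"
proof (rule filterlim_split_at)
  have "((\<lambda>u::real. u ^ n / exp u) \<longlongrightarrow> 0) at_top"
    by (rule tendsto_power_div_exp_0)
  then have "((\<lambda>t::real. (inverse t) ^ n / exp (inverse t)) \<longlongrightarrow> 0) (at_right 0)"
    by (rule filterlim_compose[OF _ filterlim_inverse_at_top_right])
  moreover have "\<forall>\<^sub>F t in at_right 0. (inverse t) ^ n / exp (inverse t) = flat n t"
    by (rule eventually_at_right_less[THEN eventually_mono])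
       (simp add: flat_def exp_minus field_simps)
  ultimately show "(flat n \<longlongrightarrow> 0) (at_right 0)"
    by (rule Lim_transform_eventually)
  have "\<forall>\<^sub>F t in at_left 0. 0 = flat n t"
    unfolding eventually_at_left_field by (auto simp: flat_def intro!: exI[of _ "-1"])
  then show "(flat n \<longlongrightarrow> 0) (at_left 0)"
    by (rule Lim_transform_eventually[OF tendsto_const])
qed

text \<open>The powers of \<open>t\<close> in the denominator are there for this formula:
  differentiating exp(-1/t) / t^n only raises the exponent, so the family is closed under
  differentiation up to linear combinations. The three cases are the two smooth branches and the
  point 0 where they meet.\<close>

lemma flat_has_derivative:
  "(flat n has_real_derivative flat (n + 2) t - n * flat (n + 1) t) (at t)"
proof -
  consider "t > 0" | "t < 0" | "t = 0" by linarith
  then show ?thesis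
  proof cases
    case 1
    have "((\<lambda>t. exp (- 1 / t) / t ^ n) has_real_derivative flat (n + 2) t - n * flat (n + 1) t) (at t)"
      using 1 by (auto intro!: derivative_eq_intros simp: flat_def field_simps power2_eq_square; cases n; auto)
    then show ?thesis
      by (rule has_field_derivative_transform_within_open[of _ _ _ "{0<..}"]) (use 1 in \<open>auto simp: flat_def\<close>)
  next
    case 2
    have "((\<lambda>t. 0) has_real_derivative flat (n + 2) t - n * flat (n + 1) t) (at t)"
      using 2 by (auto simp: flat_def)
    then show ?thesis
      by (rule has_field_derivative_transform_within_open[of _ _ _ "{..<0}"]) (use 2 in \<open>auto simp: flat_def\<close>)
  next
    case 3
    \<comment> \<open>The difference quotient at 0 is literally the next member of the family, also
      at h = 0 because division by zero gives 0. Its limit is thus \<open>flat_tendsto_0\<close> at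
      the next index.\<close>
    have "(\<lambda>h. (flat n (0 + h) - flat n 0) / h) = flat (Suc n)"
      by (auto simp: flat_def)
    then have "(flat n has_real_derivative 0) (at 0)"
      unfolding DERIV_def using flat_tendsto_0[of "Suc n"] by simp
    then show ?thesis
      using 3 by (simp add: flat_def)
  qed
qed

lemma flat_0_bounds: "0 \<le> flat 0 t" "flat 0 t \<le> 1"
  by (auto simp: flat_def)

lemma flat_0_eq_0_iff: "flat 0 t = 0 \<longleftrightarrow> t \<le> 0"
  by (auto simp: flat_def)

text \<open>Stretching the argument steepens the cutoff towards the indicator of the open half-line
  without moving its support.\<close>

lemma flat_0_scaled_tendsto:
  "(\<lambda>j. flat 0 (real (Suc j) * t)) \<longlonglongrightarrow> (if t > 0 then 1 else 0)"
proof (cases "t > 0")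
  case True
  then have "(\<lambda>j. exp (- 1 / (real (Suc j) * t))) \<longlonglongrightarrow> 1"
    by real_asymp
  moreover have "flat 0 (real (Suc j) * t) = exp (- 1 / (real (Suc j) * t))" for j
    using True by (simp add: flat_def)
  ultimately show ?thesis using True by simp
next
  case False
  then have "flat 0 (real (Suc j) * t) = 0" for j
    by (simp add: flat_0_eq_0_iff mult_nonneg_nonpos)
  with False show ?thesis by simp
qed

text \<open>Closed under partial derivatives, so its members are smooth.\<close>

inductive_set flat_algebra :: "(real^'n \<Rightarrow> real) set" where
  const: "(\<lambda>x. a) \<in> flat_algebra"
| flat: "(\<lambda>x. flat n (s * x $ i + a)) \<in> flat_algebra"
| add: "\<lbrakk>f \<in> flat_algebra; g \<in> flat_algebra\<rbrakk> \<Longrightarrow> (\<lambda>x. f x + g x) \<in> flat_algebra"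
| mult: "\<lbrakk>f \<in> flat_algebra; g \<in> flat_algebra\<rbrakk> \<Longrightarrow> (\<lambda>x. f x * g x) \<in> flat_algebra"

lemma flat_algebra_prod:
  assumes "finite I" "\<And>i. i \<in> I \<Longrightarrow> f i \<in> flat_algebra"
  shows "(\<lambda>x. \<Prod>i\<in>I. f i x) \<in> flat_algebra"
  using assms by (induction I rule: finite_induct) (auto intro: flat_algebra.intros)

text \<open>The full derivative is carried in gradient form because \<open>Ck\<close> demands
  differentiability and not just existence of the partial derivatives, which
  \<open>partial_eq\<close> then reads off as coefficients.\<close>

lemma flat_algebra_derivative:
  assumes "f \<in> flat_algebra"
  shows "\<exists>f'. (\<forall>k. f' k \<in> flat_algebra) \<and> (\<forall>x. (f has_derivative (\<lambda>h. \<Sum>k\<in>UNIV. f' k x * h $ k)) (at x))"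
  using assms
proof induction
  case (const a)
  show ?case
    by (rule exI[of _ "\<lambda>k x. 0"]) (auto intro: flat_algebra.const)
next
  case (flat n s i a)
  \<comment> \<open>The minus sign is written as a product with a constant: the algebra has rules
    for sums and products only, so in this form membership follows from the introduction
    rules.\<close>
  let ?d = "\<lambda>x. s * (flat (n + 2) (s * x $ i + a) + (- real n) * flat (n + 1) (s * x $ i + a))"
  have "((\<lambda>x. flat n (s * x $ i + a)) has_derivative (\<lambda>h. \<Sum>k\<in>UNIV. (if k = i then ?d x else 0) * h $ k)) (at x)" for x
  proof -
    have "((\<lambda>x. s * x $ i + a) has_derivative (\<lambda>h. s * h $ i)) (at x)"
      by (auto intro!: derivative_eq_intros bounded_linear.has_derivative[OF bounded_linear_vec_nth])
    from DERIV_compose_FDERIV[OF flat_has_derivative this]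
    have "((\<lambda>x. flat n (s * x $ i + a)) has_derivative (\<lambda>h. ?d x * h $ i)) (at x)"
      by (simp add: algebra_simps)
    moreover have "(\<lambda>h. \<Sum>k\<in>UNIV. (if k = i then ?d x else 0) * h $ k) = (\<lambda>h. ?d x * h $ i)"
      by (simp add: if_distrib[of "\<lambda>z. z * _"] cong: if_cong)
    ultimately show ?thesis by simp
  qed
  moreover have "?d \<in> flat_algebra"
    by (intro flat_algebra.intros)
  then have "(\<lambda>x. if k = i then ?d x else 0) \<in> flat_algebra" for k
    using flat_algebra.const[of 0] by (cases "k = i") simp_all
  ultimately show ?case
    by (intro exI[of _ "\<lambda>k x. if k = i then ?d x else 0"]) auto
next
  case (add f g)
  then obtain f' g' where "\<forall>k. f' k \<in> flat_algebra" "\<forall>k. g' k \<in> flat_algebra"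
    "\<forall>x. (f has_derivative (\<lambda>h. \<Sum>k\<in>UNIV. f' k x * h $ k)) (at x)"
    "\<forall>x. (g has_derivative (\<lambda>h. \<Sum>k\<in>UNIV. g' k x * h $ k)) (at x)" by blast
  then show ?case
    by (intro exI[of _ "\<lambda>k x. f' k x + g' k x"])
       (auto intro!: flat_algebra.intros derivative_eq_intros simp: sum.distrib algebra_simps)
next
  case (mult f g)
  then obtain f' g' where "\<forall>k. f' k \<in> flat_algebra" "\<forall>k. g' k \<in> flat_algebra"
    "\<forall>x. (f has_derivative (\<lambda>h. \<Sum>k\<in>UNIV. f' k x * h $ k)) (at x)"
    "\<forall>x. (g has_derivative (\<lambda>h. \<Sum>k\<in>UNIV. g' k x * h $ k)) (at x)" by blast
  with mult.hyps show ?case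
    by (intro exI[of _ "\<lambda>k x. f x * g' k x + f' k x * g x"])
       (auto intro!: flat_algebra.intros derivative_eq_intros
             simp: sum.distrib sum_distrib_left sum_distrib_right algebra_simps)
qed

lemma partial_eq:
  assumes "(f has_derivative (\<lambda>h. \<Sum>k\<in>UNIV. f' k * h $ k)) (at x)"
  shows "partial k f x = f' k"
  using frechet_derivative_at[OF assms, symmetric]
  by (simp add: partial_def axis_def if_distrib[of "\<lambda>z. _ * z"] cong: if_cong)

lemma flat_algebra_Ck:
  assumes "f \<in> flat_algebra"
  shows "Ck m f"
  using assms
proof (induction m arbitrary: f)
  case 0
  from flat_algebra_derivative[OF this] show ?case
    by (auto intro!: continuous_at_imp_continuous_on dest: has_derivative_continuous)
next
  case (Suc m)
  from flat_algebra_derivative[OF Suc.prems] obtain f' where f': "\<forall>k. f' k \<in> flat_algebra"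
    "\<And>x. (f has_derivative (\<lambda>h. \<Sum>k\<in>UNIV. f' k x * h $ k)) (at x)" by blast
  then have "partial k f = f' k" for k
    using partial_eq[OF f'(2)] by blast
  with f' Suc.IH show ?case
    by (auto simp: differentiable_def)
qed

text \<open>Two one-sided cutoffs per coordinate, vanishing outside the open box. Growing
  \<open>j\<close> steepens the faces, so the bumps tend to the indicator of the open box while
  staying below that of the closed box, which is what dominated convergence requires.\<close>

definition box_bump :: "real^'n \<Rightarrow> real^'n \<Rightarrow> nat \<Rightarrow> real^'n \<Rightarrow> real" where
  "box_bump a b j x =
     (\<Prod>i\<in>UNIV. flat 0 (real (Suc j) * (x $ i - a $ i)) * flat 0 (real (Suc j) * (b $ i - x $ i)))"

lemma box_bump_smooth: "smooth (box_bump a b j)"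
proof -
  have "(\<lambda>x. flat 0 (real (Suc j) * x $ i + (- real (Suc j) * a $ i)) * flat 0 (- real (Suc j) * x $ i + real (Suc j) * b $ i))
      \<in> flat_algebra" for i
    by (intro flat_algebra.intros)
  from flat_algebra_prod[OF finite_class.finite_UNIV this]
  have "box_bump a b j \<in> flat_algebra"
    by (simp add: box_bump_def[abs_def] algebra_simps)
  then show ?thesis
    using flat_algebra_Ck smooth_def by blast
qed

lemma box_bump_support: "{x. box_bump a b j x \<noteq> 0} \<subseteq> cbox a b"
proof -
  have "a $ i \<le> x $ i \<and> x $ i \<le> b $ i" if "box_bump a b j x \<noteq> 0" for x i
  proof -
    have "flat 0 (real (Suc j) * (x $ i - a $ i)) \<noteq> 0" "flat 0 (real (Suc j) * (b $ i - x $ i)) \<noteq> 0"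
      using that by (auto simp: box_bump_def)
    then show ?thesis
      by (metis flat_0_eq_0_iff diff_le_0_iff_le mult_nonneg_nonpos nle_le of_nat_0_le_iff)
  qed
  then show ?thesis by (auto simp: mem_box_cart)
qed

lemma box_bump_test_function:
  assumes "cbox a b \<subseteq> \<Omega>"
  shows "box_bump a b j \<in> test_functions \<Omega>"
proof -
  have "closure {x. box_bump a b j x \<noteq> 0} \<subseteq> cbox a b"
    using box_bump_support by (intro closure_minimal) auto
  with assms show ?thesis
    by (auto simp: test_functions_def box_bump_smooth compact_eq_bounded_closed
             intro: bounded_subset[OF bounded_cbox])
qed

lemma box_bump_bounds: "\<bar>box_bump a b j x\<bar> \<le> indicator (cbox a b) x"
proof (cases "x \<in> cbox a b")
  case True
  then show ?thesis
    unfolding box_bump_def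
    by (auto simp: abs_prod abs_mult flat_0_bounds intro!: prod_le_1 mult_le_one)
next
  case False
  then show ?thesis using box_bump_support[of a b j] by (auto simp: indicator_def)
qed

lemma box_bump_tendsto: "(\<lambda>j. box_bump a b j x) \<longlonglongrightarrow> indicator (box a b) x"
proof -
  have *: "(\<lambda>j. box_bump a b j x) \<longlonglongrightarrow>
     (\<Prod>i\<in>UNIV. (if x $ i - a $ i > 0 then 1 else 0) * (if b $ i - x $ i > 0 then 1 else 0))"
    unfolding box_bump_def by (intro tendsto_prod tendsto_mult flat_0_scaled_tendsto)
  have "(\<Prod>i\<in>UNIV. (if x $ i - a $ i > 0 then 1 else 0) * (if b $ i - x $ i > 0 then 1 else 0)) = (indicator (box a b) x :: real)"
  proof (cases "x \<in> box a b")
    case True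
    then show ?thesis by (auto simp: mem_box_cart)
  next
    case False
    then obtain i where "\<not> (a $ i < x $ i \<and> x $ i < b $ i)" by (auto simp: mem_box_cart)
    then have "\<exists>i\<in>UNIV. (if x $ i - a $ i > 0 then 1 else 0) * (if b $ i - x $ i > 0 then 1 else 0) = (0::real)"
      by (intro bexI[of _ i]) auto
    with False show ?thesis by (metis (no_types, lifting) prod_zero finite indicator_simps(2))
  qed
  with * show ?thesis by simp
qed

section \<open>Square integrable functions\<close>

lemma L2_add:
  assumes "f \<in> L2 M" "g \<in> L2 M"
  shows "(\<lambda>x. f x + g x) \<in> L2 M"
proof -
  have "integrable M (\<lambda>x. (norm (f x + g x))\<^sup>2)"
  proof (rule Bochner_Integration.integrable_bound)
    show "integrable M (\<lambda>x. 2 * (norm (f x))\<^sup>2 + 2 * (norm (g x))\<^sup>2)"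
      using assms by (auto simp: L2_def)
    have "(norm (f x + g x))\<^sup>2 \<le> 2 * (norm (f x))\<^sup>2 + 2 * (norm (g x))\<^sup>2" for x
    proof -
      have "(norm (f x + g x))\<^sup>2 \<le> (norm (f x) + norm (g x))\<^sup>2"
        by (intro power_mono norm_triangle_ineq) auto
      also have "\<dots> \<le> 2 * (norm (f x))\<^sup>2 + 2 * (norm (g x))\<^sup>2"
        using sum_squares_bound[of "norm (f x)" "norm (g x)"] by (simp add: power2_sum)
      finally show ?thesis .
    qed
    then show "AE x in M. norm ((norm (f x + g x))\<^sup>2) \<le> norm (2 * (norm (f x))\<^sup>2 + 2 * (norm (g x))\<^sup>2)"
      by simp
  qed (use assms in \<open>auto simp: L2_def\<close>)
  with assms show ?thesis by (auto simp: L2_def)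
qed

lemma L2_scaleR: "f \<in> L2 M \<Longrightarrow> (\<lambda>x. a *\<^sub>R f x) \<in> L2 M"
  by (auto simp: L2_def power_mult_distrib)

lemma L2_cmult: "f \<in> L2 M \<Longrightarrow> (\<lambda>x. a * f x :: real) \<in> L2 M"
  using L2_scaleR[of f M a] by simp

lemma L2_diff:
  assumes "f \<in> L2 M" "g \<in> L2 M"
  shows "(\<lambda>x. f x - g x) \<in> L2 M"
  using L2_add[OF assms(1) L2_scaleR[OF assms(2), of "-1"]] by simp

lemma L2_sum:
  assumes "\<And>i. i \<in> I \<Longrightarrow> f i \<in> L2 M"
  shows "(\<lambda>x. \<Sum>i\<in>I. f i x) \<in> L2 M"
  using assms
proof (induction I rule: infinite_finite_induct)
  case (insert i I)
  then show ?case using L2_add[of "f i" M "\<lambda>x. \<Sum>i\<in>I. f i x"] by simp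
qed (auto simp: L2_def)

lemma L2_inner_integrable:
  assumes "f \<in> L2 M" "g \<in> L2 M"
  shows "integrable M (\<lambda>x. f x \<bullet> g x)"
proof (rule Bochner_Integration.integrable_bound)
  show "integrable M (\<lambda>x. (norm (f x))\<^sup>2 + (norm (g x))\<^sup>2)"
    using assms by (auto simp: L2_def)
  have "\<bar>f x \<bullet> g x\<bar> \<le> (norm (f x))\<^sup>2 + (norm (g x))\<^sup>2" for x
  proof -
    have "\<bar>f x \<bullet> g x\<bar> \<le> norm (f x) * norm (g x)"
      by (rule Cauchy_Schwarz_ineq2)
    also have "\<dots> \<le> (norm (f x))\<^sup>2 + (norm (g x))\<^sup>2"
      using sum_squares_bound[of "norm (f x)" "norm (g x)"]
        mult_nonneg_nonneg[OF norm_ge_zero[of "f x"] norm_ge_zero[of "g x"]] by linarith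
    finally show ?thesis .
  qed
  then show "AE x in M. norm (f x \<bullet> g x) \<le> norm ((norm (f x))\<^sup>2 + (norm (g x))\<^sup>2)"
    by simp
qed (use assms in \<open>auto simp: L2_def\<close>)

lemma L2_mult_integrable:
  "f \<in> L2 M \<Longrightarrow> g \<in> L2 M \<Longrightarrow> integrable M (\<lambda>x. f x * g x :: real)"
  using L2_inner_integrable[of f M g] by simp

lemma Linf_mult_L2:
  assumes "z \<in> Linf M" "f \<in> L2 M"
  shows "(\<lambda>x. z x *\<^sub>R f x) \<in> L2 M"
proof -
  from assms obtain B where [measurable]: "z \<in> borel_measurable M" "f \<in> borel_measurable M"
    and B: "AE x in M. \<bar>z x\<bar> \<le> B" and f: "integrable M (\<lambda>x. (norm (f x))\<^sup>2)"
    by (auto simp: Linf_def L2_def)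
  have "integrable M (\<lambda>x. (norm (z x *\<^sub>R f x))\<^sup>2)"
  proof (rule Bochner_Integration.integrable_bound)
    show "integrable M (\<lambda>x. B\<^sup>2 * (norm (f x))\<^sup>2)"
      using f by simp
    show "AE x in M. norm ((norm (z x *\<^sub>R f x))\<^sup>2) \<le> norm (B\<^sup>2 * (norm (f x))\<^sup>2)"
      using B
    proof eventually_elim
      case (elim x)
      then have "(z x)\<^sup>2 \<le> B\<^sup>2"
        using power_mono[OF elim, of 2] by simp
      then show ?case by (simp add: power_mult_distrib mult_right_mono)
    qed
  qed measurable
  then show ?thesis by (simp add: L2_def)
qed

lemma L2_restrict_space:
  assumes "f \<in> L2 M" "S \<inter> space M \<in> sets M"
  shows "f \<in> L2 (restrict_space M S)"
proof -
  have "integrable M (\<lambda>x. indicator S x *\<^sub>R (norm (f x))\<^sup>2)"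
  proof (rule Bochner_Integration.integrable_bound)
    have "(indicator S :: _ \<Rightarrow> real) \<in> borel_measurable M"
      using assms(2) by (simp add: borel_measurable_indicator_iff Int_commute)
    then show "(\<lambda>x. indicator S x *\<^sub>R (norm (f x))\<^sup>2) \<in> borel_measurable M"
      using assms(1) by (auto simp: L2_def)
    show "integrable M (\<lambda>x. (norm (f x))\<^sup>2)"
      using assms(1) by (auto simp: L2_def)
  qed (auto simp: indicator_def)
  with assms show ?thesis
    by (auto simp: L2_def integrable_restrict_space intro: measurable_restrict_space1)
qed

lemma borel_measurable_lebesgueI: "f \<in> borel_measurable borel \<Longrightarrow> f \<in> borel_measurable lebesgue"
  by (simp add: measurable_completion)

lemma L2_compact_support:
  fixes f :: "'a::euclidean_space \<Rightarrow> real"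
  assumes meas: "f \<in> borel_measurable borel" and K: "compact K"
    and bound: "\<And>x. \<bar>f x\<bar> \<le> B * indicator K x" and S: "S \<in> sets lebesgue"
  shows "f \<in> L2 (lebesgue_on S)"
proof -
  have [measurable]: "f \<in> borel_measurable lebesgue"
    using meas by (rule borel_measurable_lebesgueI)
  have [measurable]: "K \<in> sets lebesgue"
    using K by (simp add: lmeasurable_compact fmeasurableD)
  have "integrable lebesgue (\<lambda>x. (norm (f x))\<^sup>2)"
  proof (rule Bochner_Integration.integrable_bound)
    show "integrable lebesgue (\<lambda>x. B\<^sup>2 * indicator K x)"
      using lmeasurable_compact[OF K] by (auto simp: fmeasurable_def)
    show "AE x in lebesgue. norm ((norm (f x))\<^sup>2) \<le> norm (B\<^sup>2 * indicator K x)"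
    proof (rule AE_I2)
      fix x show "norm ((norm (f x))\<^sup>2) \<le> norm (B\<^sup>2 * indicator K x)"
        using power_mono[OF bound[of x], of 2] by (cases "x \<in> K") simp_all
    qed
  qed measurable
  then have "f \<in> L2 lebesgue" by (simp add: L2_def)
  then show ?thesis using L2_restrict_space[of f lebesgue S] S by simp
qed

section \<open>Weak derivatives\<close>

lemma ae_zero_if_orthogonal_test_functions:
  fixes w :: "real^'n \<Rightarrow> real"
  assumes "open \<Omega>" and w: "w \<in> L2 (lebesgue_on \<Omega>)"
    and orth: "\<And>\<phi>. \<phi> \<in> test_functions \<Omega> \<Longrightarrow> (LINT x|lebesgue_on \<Omega>. w x * \<phi> x) = 0"
  shows "AE x in lebesgue_on \<Omega>. w x = 0"
proof -
  have \<Omega>[measurable]: "\<Omega> \<in> sets lebesgue" using \<open>open \<Omega>\<close> by auto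
  \<comment> \<open>Extension by zero: the differentiation theorem wants integrability over every
    box, including those that leave \<Omega>.\<close>
  define g where "g x = (if x \<in> \<Omega> then w x else 0)" for x
  have [measurable]: "w \<in> borel_measurable (lebesgue_on \<Omega>)" using w by (simp add: L2_def)
  have ind: "(indicator S :: _ \<Rightarrow> real) \<in> L2 (lebesgue_on \<Omega>)" if "S \<in> sets borel" "S \<subseteq> cbox a b" for S a b
    by (rule L2_compact_support[where K = "cbox a b" and B = 1]) (use that in \<open>auto simp: indicator_def\<close>)
  have wS: "integrable (lebesgue_on \<Omega>) (\<lambda>x. w x * indicator S x)" if "S \<in> sets borel" "S \<subseteq> cbox a b" for S a b
    using L2_mult_integrable[OF w ind[OF that]] .
  \<comment> \<open>Bridge from the Lebesgue integral of the orthogonality hypothesis to the gauge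
    integral of the differentiation theorem.\<close>
  have hi: "(g has_integral (LINT x|lebesgue_on \<Omega>. w x * indicator S x)) S"
    if "S \<in> sets borel" "S \<subseteq> cbox a b" for S a b
  proof -
    have "((\<lambda>x. w x * indicator S x) has_integral (LINT x|lebesgue_on \<Omega>. w x * indicator S x)) \<Omega>"
      using wS[OF that] by (rule has_integral_integral_lebesgue_on) simp
    then have "((\<lambda>x. if x \<in> \<Omega> then w x * indicator S x else 0) has_integral (LINT x|lebesgue_on \<Omega>. w x * indicator S x)) UNIV"
      by (simp add: has_integral_restrict_UNIV)
    moreover have "(\<lambda>x. if x \<in> \<Omega> then w x * indicator S x else 0) = (\<lambda>x. if x \<in> S then g x else 0)"
      by (auto simp: g_def)
    ultimately show ?thesis by (simp add: has_integral_restrict_UNIV)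
  qed
  \<comment> \<open>All averages of \<open>g\<close> over small cubes vanish, so Lebesgue differentiation gives \<open>g = 0\<close> a.e.\<close>
  have zero: "integral (cbox a b) g = 0" if "cbox a b \<subseteq> \<Omega>" for a b
  proof -
    have "(\<lambda>j. LINT x|lebesgue_on \<Omega>. w x * box_bump a b j x) \<longlonglongrightarrow> (LINT x|lebesgue_on \<Omega>. w x * indicator (box a b) x)"
    proof (rule integral_dominated_convergence)
      show "integrable (lebesgue_on \<Omega>) (\<lambda>x. \<bar>w x * indicator (cbox a b) x\<bar>)"
        using wS[of "cbox a b" a b] by simp
      have "continuous_on UNIV (box_bump a b j)" for j
        using box_bump_smooth[of a b j] Ck.simps(1) unfolding smooth_def by blast
      then have "box_bump a b j \<in> borel_measurable lebesgue" for j
        by (intro borel_measurable_lebesgueI borel_measurable_continuous_onI)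
      then have "box_bump a b j \<in> borel_measurable (lebesgue_on \<Omega>)" for j
        by (rule measurable_restrict_space1)
      then show "(\<lambda>x. w x * box_bump a b j x) \<in> borel_measurable (lebesgue_on \<Omega>)" for j
        by simp
      show "(\<lambda>x. w x * indicator (box a b) x) \<in> borel_measurable (lebesgue_on \<Omega>)"
        using wS[of "box a b" a b] box_subset_cbox by auto
      show "AE x in lebesgue_on \<Omega>. (\<lambda>j. w x * box_bump a b j x) \<longlonglongrightarrow> w x * indicator (box a b) x"
        by (intro AE_I2 tendsto_mult tendsto_const box_bump_tendsto)
      show "AE x in lebesgue_on \<Omega>. norm (w x * box_bump a b j x) \<le> \<bar>w x * indicator (cbox a b) x\<bar>" for j
        by (rule AE_I2) (use box_bump_bounds[of a b j] in \<open>auto simp: abs_mult mult_left_mono\<close>)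
    qed
    moreover have "(LINT x|lebesgue_on \<Omega>. w x * box_bump a b j x) = 0" for j
      using orth box_bump_test_function[OF that] by blast
    ultimately have "(LINT x|lebesgue_on \<Omega>. w x * indicator (box a b) x) = 0"
      by (simp add: LIMSEQ_const_iff)
    then have "integral (box a b) g = 0"
      using integral_unique[OF hi[of "box a b" a b, OF _ box_subset_cbox]] by simp
    then show ?thesis by (simp add: integral_open_interval)
  qed
  have "g integrable_on cbox a b" for a b
    using hi[of "cbox a b" a b] by (auto simp: integrable_on_def)
  from integrable_ccontinuous_explicit[of g, OF this] obtain N where N: "negligible N"
    and lim: "\<And>x e. \<lbrakk>x \<notin> N; 0 < e\<rbrakk> \<Longrightarrow> \<exists>d>0. \<forall>h. 0 < h \<and> h < d \<longrightarrow>
        norm (integral (cbox x (x + h *\<^sub>R One)) g /\<^sub>R h ^ DIM(real^'n) - g x) < e"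
    by blast
  have w0: "w x = 0" if "x \<in> \<Omega>" "x \<notin> N" for x
  proof (rule ccontr)
    assume "w x \<noteq> 0"
    \<comment> \<open>The tolerance is the absolute value of \<open>w x\<close> itself, so a
      vanishing average already contradicts the strict inequality.\<close>
    with that lim[of x "\<bar>w x\<bar>"] obtain d where d: "d > 0"
      "\<And>h. 0 < h \<Longrightarrow> h < d \<Longrightarrow> norm (integral (cbox x (x + h *\<^sub>R One)) g /\<^sub>R h ^ DIM(real^'n) - w x) < \<bar>w x\<bar>"
      by (auto simp: g_def)
    obtain r where r: "r > 0" "cball x r \<subseteq> \<Omega>"
      using \<open>open \<Omega>\<close> \<open>x \<in> \<Omega>\<close> open_contains_cball by blast
    \<comment> \<open>A cube of side \<open>h\<close> with corner \<open>x\<close> reaches at most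
      \<open>h * norm One\<close> away from \<open>x\<close>, hence stays in the ball of radius
      \<open>r\<close> if \<open>h\<close> is at most \<open>R\<close>. The summand 1 keeps the
      denominator positive at sight.\<close>
    define R where "R = r / (1 + norm (One :: real^'n))"
    have R: "R > 0" using r by (simp add: R_def add_pos_nonneg)
    define h where "h = min (d / 2) R"
    have h: "0 < h" "h < d" "h \<le> R" using d R by (auto simp: h_def)
    have "cbox x (x + h *\<^sub>R One) \<subseteq> cball x r"
    proof
      fix y assume "y \<in> cbox x (x + h *\<^sub>R One)"
      then have "norm (y - x) \<le> norm (h *\<^sub>R (One :: real^'n))"
        by (intro norm_le_componentwise) (auto simp: mem_box inner_diff_left inner_add_left abs_le_iff algebra_simps)
      also have "\<dots> \<le> R * (1 + norm (One :: real^'n))"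
        using h by (auto intro!: mult_mono)
      also have "\<dots> = r"
        unfolding R_def by (metis add_pos_nonneg less_numeral_extra(1,3) nonzero_divide_eq_eq norm_ge_zero)
      finally show "y \<in> cball x r" by (simp add: dist_norm norm_minus_commute)
    qed
    with r zero have "integral (cbox x (x + h *\<^sub>R One)) g = 0" by blast
    with d(2)[OF h(1,2)] show False by simp
  qed
  have "AE x in lebesgue. x \<notin> N"
    using N negligible_iff_null_sets by (metis AE_not_in)
  then show ?thesis
    using w0 by (subst AE_restrict_space_iff) auto
qed

section \<open>Linearity and uniqueness of weak derivatives\<close>

lemma continuous_compact_support_L2:
  fixes f :: "real^'n \<Rightarrow> real"
  assumes "continuous_on UNIV f" "compact K" "\<And>x. x \<notin> K \<Longrightarrow> f x = 0" "S \<in> sets lebesgue"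
  shows "f \<in> L2 (lebesgue_on S)"
proof -
  have "bounded (f ` K)"
    by (intro compact_imp_bounded compact_continuous_image continuous_on_subset[OF assms(1)] assms(2)) simp
  then obtain B where "\<And>x. x \<in> K \<Longrightarrow> \<bar>f x\<bar> \<le> B"
    by (auto simp: bounded_iff)
  then have "\<bar>f x\<bar> \<le> B * indicator K x" for x
    using assms(3)[of x] by (cases "x \<in> K") auto
  then show ?thesis
    by (rule L2_compact_support[OF borel_measurable_continuous_onI[OF assms(1)] assms(2) _ assms(4)])
qed

lemma smooth_continuous: "smooth f \<Longrightarrow> continuous_on UNIV f"
  unfolding smooth_def by (drule spec[of _ 0]) simp

lemma smooth_partial_continuous: "smooth f \<Longrightarrow> continuous_on UNIV (partial k f)"
  unfolding smooth_def by (drule spec[of _ "Suc 0"]) simp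

lemma smooth_differentiable: "smooth f \<Longrightarrow> f differentiable (at x)"
  unfolding smooth_def by (drule spec[of _ "Suc 0"]) simp

lemma test_function_L2:
  assumes "\<phi> \<in> test_functions \<Omega>" "S \<in> sets lebesgue"
  shows "\<phi> \<in> L2 (lebesgue_on S)" "partial k \<phi> \<in> L2 (lebesgue_on S)"
proof -
  let ?K = "closure {x. \<phi> x \<noteq> 0}"
  have \<phi>: "smooth \<phi>" "compact ?K" using assms by (auto simp: test_functions_def)
  have 0: "\<phi> x = 0" if "x \<notin> ?K" for x
    using that closure_subset[of "{x. \<phi> x \<noteq> 0}"] by (metis (mono_tags, lifting) mem_Collect_eq subsetD)
  then show "\<phi> \<in> L2 (lebesgue_on S)"
    by (rule continuous_compact_support_L2[OF smooth_continuous[OF \<phi>(1)] \<phi>(2) _ assms(2)])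
  have "partial k \<phi> x = 0" if "x \<notin> ?K" for x
  proof -
    \<comment> \<open>The complement of the closed support is open and the function is constantly
      zero there, so the derivative vanishes too.\<close>
    have "(\<phi> has_derivative (\<lambda>h. 0)) (at x)"
    proof (rule has_derivative_transform_within_open[OF has_derivative_const])
      show "open (- ?K)" by (rule open_Compl) (rule closed_closure)
      show "x \<in> - ?K" using that unfolding Compl_iff .
      show "0 = \<phi> y" if "y \<in> - ?K" for y using 0[of y] that by (metis ComplD)
    qed
    then have "(\<phi> has_derivative (\<lambda>h. \<Sum>k\<in>UNIV. 0 * h $ k)) (at x)"
      by simp
    then show ?thesis by (rule partial_eq)
  qed
  then show "partial k \<phi> \<in> L2 (lebesgue_on S)"
    by (rule continuous_compact_support_L2[OF smooth_partial_continuous[OF \<phi>(1)] \<phi>(2) _ assms(2)])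
qed

text \<open>Square integrability makes every product with a test function integrable. This is what
  permits splitting the integrals: the integral of a non-integrable function defaults to 0 and is
  not additive.\<close>

lemma has_weak_partial_lincomb:
  assumes S: "\<Omega> \<in> sets lebesgue"
    and L2: "v \<in> L2 (lebesgue_on \<Omega>)" "w \<in> L2 (lebesgue_on \<Omega>)" "Dv \<in> L2 (lebesgue_on \<Omega>)" "Dw \<in> L2 (lebesgue_on \<Omega>)"
    and weak: "has_weak_partial \<Omega> k v Dv" "has_weak_partial \<Omega> k w Dw"
  shows "has_weak_partial \<Omega> k (\<lambda>x. a * v x + b * w x) (\<lambda>x. a * Dv x + b * Dw x)"
  unfolding has_weak_partial_def
proof
  fix \<phi> assume \<phi>: "\<phi> \<in> test_functions \<Omega>"
  note L = test_function_L2[OF \<phi> S]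
  have "(LINT x|lebesgue_on \<Omega>. (a * v x + b * w x) * partial k \<phi> x) =
      (LINT x|lebesgue_on \<Omega>. a * (v x * partial k \<phi> x) + b * (w x * partial k \<phi> x))"
    by (simp add: algebra_simps)
  also have "\<dots> = a * (LINT x|lebesgue_on \<Omega>. v x * partial k \<phi> x) + b * (LINT x|lebesgue_on \<Omega>. w x * partial k \<phi> x)"
    using L2_mult_integrable[OF L2(1) L(2)] L2_mult_integrable[OF L2(2) L(2)] by simp
  also have "\<dots> = - (a * (LINT x|lebesgue_on \<Omega>. Dv x * \<phi> x) + b * (LINT x|lebesgue_on \<Omega>. Dw x * \<phi> x))"
    using weak \<phi> by (simp add: has_weak_partial_def)
  also have "\<dots> = - (LINT x|lebesgue_on \<Omega>. a * (Dv x * \<phi> x) + b * (Dw x * \<phi> x))"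
    using L2_mult_integrable[OF L2(3) L(1)] L2_mult_integrable[OF L2(4) L(1)] by simp
  also have "\<dots> = - (LINT x|lebesgue_on \<Omega>. (a * Dv x + b * Dw x) * \<phi> x)"
    by (simp add: algebra_simps)
  finally show "(LINT x|lebesgue_on \<Omega>. (a * v x + b * w x) * partial k \<phi> x) = - (LINT x|lebesgue_on \<Omega>. (a * Dv x + b * Dw x) * \<phi> x)" .
qed

lemma has_weak_partial_unique:
  assumes "open \<Omega>" and L2: "D \<in> L2 (lebesgue_on \<Omega>)" "D' \<in> L2 (lebesgue_on \<Omega>)"
    and weak: "has_weak_partial \<Omega> k w D" "has_weak_partial \<Omega> k w D'"
  shows "AE x in lebesgue_on \<Omega>. D x = D' x"
proof -
  have "(LINT x|lebesgue_on \<Omega>. (D x - D' x) * \<phi> x) = 0" if \<phi>: "\<phi> \<in> test_functions \<Omega>" for \<phi>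
  proof -
    have L: "\<phi> \<in> L2 (lebesgue_on \<Omega>)"
      using test_function_L2(1)[OF \<phi>] \<open>open \<Omega>\<close> by auto
    have "(LINT x|lebesgue_on \<Omega>. (D x - D' x) * \<phi> x) = (LINT x|lebesgue_on \<Omega>. D x * \<phi> x - D' x * \<phi> x)"
      by (simp add: algebra_simps)
    also have "\<dots> = (LINT x|lebesgue_on \<Omega>. D x * \<phi> x) - (LINT x|lebesgue_on \<Omega>. D' x * \<phi> x)"
      using L2_mult_integrable[OF L2(1) L] L2_mult_integrable[OF L2(2) L] by simp
    also have "\<dots> = 0"
      using bspec[OF weak(1)[unfolded has_weak_partial_def] \<phi>] bspec[OF weak(2)[unfolded has_weak_partial_def] \<phi>]
      by linarith
    finally show ?thesis .
  qed
  from ae_zero_if_orthogonal_test_functions[OF \<open>open \<Omega>\<close> L2_diff[OF L2] this]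
  show ?thesis by simp
qed

lemma H1_L2: "w \<in> H1 \<Omega> \<Longrightarrow> w \<in> L2 (lebesgue_on \<Omega>)"
  by (simp add: H1_def)

lemma weak_partial_has_weak_partial:
  assumes "w \<in> H1 \<Omega>"
  shows "weak_partial \<Omega> k w \<in> L2 (lebesgue_on \<Omega>)" "has_weak_partial \<Omega> k w (weak_partial \<Omega> k w)"
proof -
  have "\<exists>D. D \<in> L2 (lebesgue_on \<Omega>) \<and> has_weak_partial \<Omega> k w D"
    using assms by (auto simp: H1_def)
  from someI_ex[OF this]
  show "weak_partial \<Omega> k w \<in> L2 (lebesgue_on \<Omega>)" "has_weak_partial \<Omega> k w (weak_partial \<Omega> k w)"
    by (simp_all add: weak_partial_def)
qed

lemma lincomb_has_weak_partial:
  assumes "open \<Omega>" "v \<in> H1 \<Omega>" "w \<in> H1 \<Omega>"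
  shows "(\<lambda>x. a * weak_partial \<Omega> k v x + b * weak_partial \<Omega> k w x) \<in> L2 (lebesgue_on \<Omega>)"
    and "has_weak_partial \<Omega> k (\<lambda>x. a * v x + b * w x) (\<lambda>x. a * weak_partial \<Omega> k v x + b * weak_partial \<Omega> k w x)"
proof -
  note v = H1_L2[OF assms(2)] weak_partial_has_weak_partial[OF assms(2), of k]
  note w = H1_L2[OF assms(3)] weak_partial_has_weak_partial[OF assms(3), of k]
  show "(\<lambda>x. a * weak_partial \<Omega> k v x + b * weak_partial \<Omega> k w x) \<in> L2 (lebesgue_on \<Omega>)"
    by (rule L2_add[OF L2_cmult[OF v(2)] L2_cmult[OF w(2)]])
  have "\<Omega> \<in> sets lebesgue" using assms(1) by simp
  then show "has_weak_partial \<Omega> k (\<lambda>x. a * v x + b * w x) (\<lambda>x. a * weak_partial \<Omega> k v x + b * weak_partial \<Omega> k w x)"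
    by (rule has_weak_partial_lincomb[OF _ v(1) w(1) v(2) w(2) v(3) w(3)])
qed

lemma H1_lincomb:
  assumes "open \<Omega>" "v \<in> H1 \<Omega>" "w \<in> H1 \<Omega>"
  shows "(\<lambda>x. a * v x + b * w x) \<in> H1 \<Omega>"
  unfolding H1_def mem_Collect_eq
  using lincomb_has_weak_partial[OF assms] L2_add[OF L2_cmult[OF H1_L2[OF assms(2)]] L2_cmult[OF H1_L2[OF assms(3)]]]
  by blast

text \<open>Both sides are square integrable weak derivatives of the same function, so uniqueness
  identifies them. Representatives picked by \<open>SOME\<close> cannot be expected to agree
  pointwise, hence the exceptional null set.\<close>

lemma weak_partial_lincomb:
  assumes "open \<Omega>" "v \<in> H1 \<Omega>" "w \<in> H1 \<Omega>"
  shows "AE x in lebesgue_on \<Omega>. weak_partial \<Omega> k (\<lambda>x. a * v x + b * w x) x =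
           a * weak_partial \<Omega> k v x + b * weak_partial \<Omega> k w x"
  by (rule has_weak_partial_unique[OF assms(1) weak_partial_has_weak_partial(1)[OF H1_lincomb[OF assms]]
        lincomb_has_weak_partial(1)[OF assms] weak_partial_has_weak_partial(2)[OF H1_lincomb[OF assms]]
        lincomb_has_weak_partial(2)[OF assms]])

section \<open>Surface measure and traces\<close>

text \<open>\<open>measure_of\<close> takes its sigma-algebra from the generating sets alone,
  whatever \<open>hausdorff_outer\<close> does on them. Measurability questions about surfaces are
  thereby reduced to Borel sets.\<close>

lemma sets_hausdorff_measure: "sets (hausdorff_measure s) = sets borel"
proof -
  have "sets (hausdorff_measure s) = sigma_sets UNIV (sets (borel :: 'a measure))"
    unfolding hausdorff_measure_def by (rule sets_measure_of) simp
  also have "\<dots> = sets borel"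
    using sets.sigma_sets_eq[of "borel :: 'a measure"] by simp
  finally show ?thesis .
qed

lemma space_hausdorff_measure: "space (hausdorff_measure s) = UNIV"
  using sets_eq_imp_space_eq[OF sets_hausdorff_measure] by simp

lemma borel_measurable_surface_measure:
  assumes "f \<in> borel_measurable borel"
  shows "f \<in> borel_measurable (surface_measure S)"
proof -
  have "f \<in> borel_measurable (hausdorff_measure s)" for s
    using assms measurable_cong_sets[OF sets_hausdorff_measure refl] by blast
  then show ?thesis
    unfolding surface_measure_def by (intro measurable_restrict_space1 measurable_completion)
qed

text \<open>For Borel sets, restricting in two stages is restricting once. In this way square
  integrability and null sets known on a whole frontier descend to \<Gamma> and to the Dirichlet and
  Neumann parts.\<close>

lemma restrict_surface_measure:
  assumes "S \<in> sets borel" "T \<in> sets borel" "T \<subseteq> S"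
  shows "surface_measure T = restrict_space (surface_measure S) T"
    and "T \<inter> space (surface_measure S) \<in> sets (surface_measure S)"
proof -
  have b: "A \<inter> space (completion (hausdorff_measure s)) \<in> sets (completion (hausdorff_measure s))" if "A \<in> sets borel" for A :: "(real^'n) set" and s
    using that by (simp add: space_hausdorff_measure sets_completionI_sets sets_hausdorff_measure)
  show "surface_measure T = restrict_space (surface_measure S) T"
    unfolding surface_measure_def restrict_restrict_space[OF b[OF assms(1)] b[OF assms(2)]] Int_absorb1[OF assms(3)] ..
  have "T \<in> sets (completion (hausdorff_measure (real CARD('n) - 1)))"
    using assms by (simp add: sets_completionI_sets sets_hausdorff_measure)
  then have "T \<in> sets (surface_measure S)"
    using assms unfolding surface_measure_def sets_restrict_space by (auto intro!: image_eqI[of _ _ T])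
  then show "T \<inter> space (surface_measure S) \<in> sets (surface_measure S)"
    by (simp add: sets.Int_space_eq2)
qed

lemma L2_surface_measure_mono:
  assumes "S \<in> sets borel" "T \<in> sets borel" "T \<subseteq> S" "f \<in> L2 (surface_measure S)"
  shows "f \<in> L2 (surface_measure T)"
  using restrict_surface_measure[OF assms(1-3)] L2_restrict_space[OF assms(4)] by simp

lemma AE_surface_measure_mono:
  assumes "S \<in> sets borel" "T \<in> sets borel" "T \<subseteq> S" "AE x in surface_measure S. P x"
  shows "AE x in surface_measure T. P x"
proof -
  note T = restrict_surface_measure[OF assms(1-3)]
  have "AE x in surface_measure S. x \<in> T \<longrightarrow> P x"
    using assms(4) by (rule AE_mp) (rule AE_I2, blast)
  then have "AE x in restrict_space (surface_measure S) T. P x"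
    by (rule AE_restrict_space_iff[OF T(2), THEN iffD2])
  then show ?thesis by (subst T(1))
qed

section \<open>Linearity of the trace relation\<close>

lemma partial_lincomb:
  assumes "f differentiable (at x)" "g differentiable (at x)"
  shows "partial k (\<lambda>x. a * f x + b * g x) x = a * partial k f x + b * partial k g x"
proof -
  have "((\<lambda>x. a * f x + b * g x) has_derivative
      (\<lambda>h. a * frechet_derivative f (at x) h + b * frechet_derivative g (at x) h)) (at x)"
    using assms by (intro has_derivative_add has_derivative_mult_right) (auto simp: frechet_derivative_works)
  from frechet_derivative_at[OF this, symmetric]
  show ?thesis by (simp add: partial_def)
qed

lemma Ck_lincomb:
  assumes "Ck m f" "Ck m g"
  shows "Ck m (\<lambda>x. a * f x + b * g x)"
  using assms
proof (induction m arbitrary: f g)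
  case 0
  then show ?case by (auto intro!: continuous_intros)
next
  case (Suc m)
  then have diff: "f differentiable (at x)" "g differentiable (at x)" for x
    by auto
  have "partial k (\<lambda>x. a * f x + b * g x) = (\<lambda>x. a * partial k f x + b * partial k g x)" for k
    by (rule ext) (rule partial_lincomb[OF diff])
  moreover have "Ck m (\<lambda>x. a * partial k f x + b * partial k g x)" for k
    using Suc.prems by (intro Suc.IH) simp_all
  moreover have "(\<lambda>x. a * f x + b * g x) differentiable (at x)" for x
    by (intro differentiable_add differentiable_mult differentiable_const diff)
  ultimately show ?case
    unfolding Ck.simps by simp
qed

lemma smooth_lincomb: "smooth f \<Longrightarrow> smooth g \<Longrightarrow> smooth (\<lambda>x. a * f x + b * g x)"
  by (simp add: smooth_def Ck_lincomb)

text \<open>Serves the three convergences inside \<open>has_trace\<close>: of the functions, of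
  their derivatives and of the boundary values. The identity for \<open>F\<close> is required only
  almost everywhere because chosen weak derivatives are linear only in that sense.\<close>

lemma nn_integral_square_lincomb_tendsto_0:
  fixes f g :: "nat \<Rightarrow> 'a \<Rightarrow> real"
  assumes [measurable]: "\<And>j. f j \<in> borel_measurable M" "\<And>j. g j \<in> borel_measurable M"
    and f: "(\<lambda>j. \<integral>\<^sup>+x. ennreal ((f j x)\<^sup>2) \<partial>M) \<longlonglongrightarrow> 0"
    and g: "(\<lambda>j. \<integral>\<^sup>+x. ennreal ((g j x)\<^sup>2) \<partial>M) \<longlonglongrightarrow> 0"
    and F: "\<And>j. AE x in M. F j x = a * f j x + b * g j x"
  shows "(\<lambda>j. \<integral>\<^sup>+x. ennreal ((F j x)\<^sup>2) \<partial>M) \<longlonglongrightarrow> 0"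
proof (rule tendsto_sandwich[OF _ _ tendsto_const])
  let ?B = "\<lambda>j. ennreal (2 * a\<^sup>2) * (\<integral>\<^sup>+x. ennreal ((f j x)\<^sup>2) \<partial>M) + ennreal (2 * b\<^sup>2) * (\<integral>\<^sup>+x. ennreal ((g j x)\<^sup>2) \<partial>M)"
  have "?B \<longlonglongrightarrow> ennreal (2 * a\<^sup>2) * 0 + ennreal (2 * b\<^sup>2) * 0"
    by (intro tendsto_add ennreal_tendsto_cmult f g) auto
  then show "?B \<longlonglongrightarrow> 0" by simp
  have "(\<integral>\<^sup>+x. ennreal ((F j x)\<^sup>2) \<partial>M) \<le> ?B j" for j
  proof -
    have "(\<integral>\<^sup>+x. ennreal ((F j x)\<^sup>2) \<partial>M) \<le>
        (\<integral>\<^sup>+x. ennreal (2 * a\<^sup>2) * ennreal ((f j x)\<^sup>2) + ennreal (2 * b\<^sup>2) * ennreal ((g j x)\<^sup>2) \<partial>M)"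
    proof (rule nn_integral_mono_AE)
      show "AE x in M. ennreal ((F j x)\<^sup>2) \<le> ennreal (2 * a\<^sup>2) * ennreal ((f j x)\<^sup>2) + ennreal (2 * b\<^sup>2) * ennreal ((g j x)\<^sup>2)"
        using F[of j]
      proof eventually_elim
        case (elim x)
        have "(F j x)\<^sup>2 \<le> 2 * a\<^sup>2 * (f j x)\<^sup>2 + 2 * b\<^sup>2 * (g j x)\<^sup>2"
          using sum_squares_bound[of "a * f j x" "b * g j x"] by (simp add: elim power2_sum power_mult_distrib)
        then have "ennreal ((F j x)\<^sup>2) \<le> ennreal (2 * a\<^sup>2 * (f j x)\<^sup>2 + 2 * b\<^sup>2 * (g j x)\<^sup>2)"
          by (rule ennreal_leI)
        then show ?case by (simp add: ennreal_plus ennreal_mult)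
      qed
    qed
    also have "\<dots> = ?B j"
      by (simp add: nn_integral_add nn_integral_cmult)
    finally show ?thesis .
  qed
  then show "\<forall>\<^sub>F j in sequentially. (\<integral>\<^sup>+x. ennreal ((F j x)\<^sup>2) \<partial>M) \<le> ?B j" by simp
qed simp

text \<open>The trace relation is the closure of the graph of a linear map, so combining two
  approximating sequences termwise approximates the combination.\<close>

lemma has_trace_lincomb:
  assumes "open \<Omega>" and v: "has_trace \<Omega> v g" and w: "has_trace \<Omega> w h"
  shows "has_trace \<Omega> (\<lambda>x. a * v x + b * w x) (\<lambda>x. a * g x + b * h x)"
proof -
  let ?L = "lebesgue_on \<Omega>" and ?S = "surface_measure (frontier \<Omega>)"
  from v obtain \<phi> where H1v: "v \<in> H1 \<Omega>" and g: "g \<in> L2 ?S" and \<phi>: "\<And>j. smooth (\<phi> j)"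
    "(\<lambda>j. \<integral>\<^sup>+x. ennreal ((\<phi> j x - v x)\<^sup>2) \<partial>?L) \<longlonglongrightarrow> 0"
    "\<And>k. (\<lambda>j. \<integral>\<^sup>+x. ennreal ((partial k (\<phi> j) x - weak_partial \<Omega> k v x)\<^sup>2) \<partial>?L) \<longlonglongrightarrow> 0"
    "(\<lambda>j. \<integral>\<^sup>+x. ennreal ((\<phi> j x - g x)\<^sup>2) \<partial>?S) \<longlonglongrightarrow> 0"
    unfolding has_trace_def by blast
  from w obtain \<psi> where H1w: "w \<in> H1 \<Omega>" and h: "h \<in> L2 ?S" and \<psi>: "\<And>j. smooth (\<psi> j)"
    "(\<lambda>j. \<integral>\<^sup>+x. ennreal ((\<psi> j x - w x)\<^sup>2) \<partial>?L) \<longlonglongrightarrow> 0"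
    "\<And>k. (\<lambda>j. \<integral>\<^sup>+x. ennreal ((partial k (\<psi> j) x - weak_partial \<Omega> k w x)\<^sup>2) \<partial>?L) \<longlonglongrightarrow> 0"
    "(\<lambda>j. \<integral>\<^sup>+x. ennreal ((\<psi> j x - h x)\<^sup>2) \<partial>?S) \<longlonglongrightarrow> 0"
    unfolding has_trace_def by blast
  have cL: "f \<in> borel_measurable ?L" if "continuous_on UNIV f" for f :: "real^'a \<Rightarrow> real"
    by (intro measurable_restrict_space1 borel_measurable_lebesgueI borel_measurable_continuous_onI that)
  have cS: "f \<in> borel_measurable ?S" if "continuous_on UNIV f" for f :: "real^'a \<Rightarrow> real"
    by (intro borel_measurable_surface_measure borel_measurable_continuous_onI that)
  have mL: "u \<in> H1 \<Omega> \<Longrightarrow> u \<in> borel_measurable ?L" for u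
    using H1_L2[of u \<Omega>] by (simp add: L2_def)
  have mP: "u \<in> H1 \<Omega> \<Longrightarrow> weak_partial \<Omega> k u \<in> borel_measurable ?L" for u k
    using weak_partial_has_weak_partial(1)[of u \<Omega> k] by (simp add: L2_def)
  have mS: "u \<in> L2 ?S \<Longrightarrow> u \<in> borel_measurable ?S" for u :: "real^'a \<Rightarrow> real"
    by (simp add: L2_def)
  define \<theta> where "\<theta> j x = a * \<phi> j x + b * \<psi> j x" for j x
  have "smooth (\<theta> j)" for j
    unfolding \<theta>_def using smooth_lincomb[OF \<phi>(1) \<psi>(1)] by simp
  moreover have "(\<lambda>j. \<integral>\<^sup>+x. ennreal ((\<theta> j x - (a * v x + b * w x))\<^sup>2) \<partial>?L) \<longlonglongrightarrow> 0"
  proof (rule nn_integral_square_lincomb_tendsto_0[OF _ _ \<phi>(2) \<psi>(2)])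
    show "(\<lambda>x. \<phi> j x - v x) \<in> borel_measurable ?L" "(\<lambda>x. \<psi> j x - w x) \<in> borel_measurable ?L" for j
      by (intro borel_measurable_diff cL mL smooth_continuous \<phi> \<psi> H1v H1w)+
    show "AE x in ?L. \<theta> j x - (a * v x + b * w x) = a * (\<phi> j x - v x) + b * (\<psi> j x - w x)" for j
      by (simp add: \<theta>_def algebra_simps)
  qed
  moreover have "(\<lambda>j. \<integral>\<^sup>+x. ennreal ((partial k (\<theta> j) x - weak_partial \<Omega> k (\<lambda>x. a * v x + b * w x) x)\<^sup>2) \<partial>?L) \<longlonglongrightarrow> 0" for k
  proof (rule nn_integral_square_lincomb_tendsto_0[OF _ _ \<phi>(3)[of k] \<psi>(3)[of k]])
    show "(\<lambda>x. partial k (\<phi> j) x - weak_partial \<Omega> k v x) \<in> borel_measurable ?L"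
      "(\<lambda>x. partial k (\<psi> j) x - weak_partial \<Omega> k w x) \<in> borel_measurable ?L" for j
      by (intro borel_measurable_diff cL mP smooth_partial_continuous \<phi> \<psi> H1v H1w)+
    show "AE x in ?L. partial k (\<theta> j) x - weak_partial \<Omega> k (\<lambda>x. a * v x + b * w x) x =
       a * (partial k (\<phi> j) x - weak_partial \<Omega> k v x) + b * (partial k (\<psi> j) x - weak_partial \<Omega> k w x)" for j
      using weak_partial_lincomb[OF \<open>open \<Omega>\<close> H1v H1w, of k a b]
    proof eventually_elim
      case (elim x)
      have "partial k (\<theta> j) x = a * partial k (\<phi> j) x + b * partial k (\<psi> j) x"
        unfolding \<theta>_def by (intro partial_lincomb smooth_differentiable \<phi> \<psi>)
      with elim show ?case by (simp add: algebra_simps)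
    qed
  qed
  moreover have "(\<lambda>j. \<integral>\<^sup>+x. ennreal ((\<theta> j x - (a * g x + b * h x))\<^sup>2) \<partial>?S) \<longlonglongrightarrow> 0"
  proof (rule nn_integral_square_lincomb_tendsto_0[OF _ _ \<phi>(4) \<psi>(4)])
    show "(\<lambda>x. \<phi> j x - g x) \<in> borel_measurable ?S" "(\<lambda>x. \<psi> j x - h x) \<in> borel_measurable ?S" for j
      by (intro borel_measurable_diff cS mS smooth_continuous \<phi> \<psi> g h)+
    show "AE x in ?S. \<theta> j x - (a * g x + b * h x) = a * (\<phi> j x - g x) + b * (\<psi> j x - h x)" for j
      by (simp add: \<theta>_def algebra_simps)
  qed
  moreover have "(\<lambda>x. a * v x + b * w x) \<in> H1 \<Omega>"
    by (rule H1_lincomb[OF \<open>open \<Omega>\<close> H1v H1w])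
  moreover have "(\<lambda>x. a * g x + b * h x) \<in> L2 ?S"
    by (rule L2_add[OF L2_cmult[OF g] L2_cmult[OF h]])
  ultimately show ?thesis unfolding has_trace_def by blast
qed

text \<open>Values chosen freely on a basis of the domain of \<open>R\<close> and extended linearly
  remain compatible with \<open>R\<close> on that domain, since \<open>R\<close> is itself linear.
  The last conclusion also covers \<open>w\<close> outside the domain; for traces it is the source
  of square integrability on all of \<open>H1\<close>.\<close>

lemma linear_selection:
  fixes R :: "('a \<Rightarrow> real) \<Rightarrow> ('b \<Rightarrow> real) \<Rightarrow> bool"
  assumes "R v0 g0"
    and lincomb: "\<And>v w g h a b. R v g \<Longrightarrow> R w h \<Longrightarrow> R (\<lambda>x. a * v x + b * w x) (\<lambda>x. a * g x + b * h x)"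
  obtains T where "\<And>a b v w. T (\<lambda>x. a * v x + b * w x) = (\<lambda>x. a * T v x + b * T w x)"
    and "\<And>w g. R w g \<Longrightarrow> R w (T w)" and "\<And>w. \<exists>v. R v (T w)"
proof -
  \<comment> \<open>Pointwise scaling; together with pointwise addition it makes the space of all
    real functions a vector space, so that basis arguments apply to it.\<close>
  define s1 :: "real \<Rightarrow> ('a \<Rightarrow> real) \<Rightarrow> 'a \<Rightarrow> real" where "s1 a f = (\<lambda>x. a * f x)" for a f
  define s2 :: "real \<Rightarrow> ('b \<Rightarrow> real) \<Rightarrow> 'b \<Rightarrow> real" where "s2 a f = (\<lambda>x. a * f x)" for a f
  interpret vs1: vector_space s1
    by unfold_locales (auto simp: s1_def fun_eq_iff algebra_simps)
  interpret vs2: vector_space s2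
    by unfold_locales (auto simp: s2_def fun_eq_iff algebra_simps)
  interpret vector_space_pair s1 s2 ..
  have R0: "R 0 0"
    using lincomb[OF assms(1) assms(1), of 0 0] by (simp add: zero_fun_def)
  have R_add: "R (v + w) (g + h)" if "R v g" "R w h" for v w g h
    using lincomb[OF that, of 1 1] by (simp add: plus_fun_def)
  have R_scale: "R (s1 a v) (s2 a g)" if "R v g" for a v g
    using lincomb[OF that that, of a 0] by (simp add: s1_def s2_def)
  \<comment> \<open>A Hamel basis of the domain of \<open>R\<close>.\<close>
  obtain B where B: "B \<subseteq> {v. \<exists>g. R v g}" "vs1.independent B" "{v. \<exists>g. R v g} \<subseteq> vs1.span B"
    by (rule vs1.maximal_independent_subset)
  define f where "f v = (SOME g. R v g)" for v
  have f: "R v (f v)" if "v \<in> B" for v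
    using B(1) that someI_ex[of "R v"] by (auto simp: f_def)
  \<comment> \<open>This extension has its range in the span of the chosen values. A bare linear
    extension would leave the values off the span of \<open>B\<close> uncontrolled.\<close>
  obtain T where T: "Vector_Spaces.linear s1 s2 T" "\<And>v. v \<in> B \<Longrightarrow> T v = f v" "range T = vs2.span (f ` B)"
    using linear_independent_extend_subspace[OF B(2), of f] by blast
  interpret T: Vector_Spaces.linear s1 s2 T by (rule T(1))
  have RT: "R w (T w)" if "w \<in> vs1.span B" for w
    using that
  proof (induction rule: vs1.span_induct_alt)
    case base
    then show ?case using R0 by (simp only: T.zero)
  next
    case (step c x y)
    have "T (s1 c x + y) = s2 c (f x) + T y"
      using step(1) by (simp only: T.add T.scale T(2))
    then show ?case
      using R_add[OF R_scale[OF f[OF step(1)]] step(2), of c] by (simp only:)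
  qed
  have rng: "\<exists>v. R v g" if "g \<in> vs2.span (f ` B)" for g
    using that
  proof (induction rule: vs2.span_induct_alt)
    case base
    then show ?case using R0 by blast
  next
    case (step c x y)
    then show ?case
      using R_add[OF R_scale] f by blast
  qed
  show thesis
  proof
    show "T (\<lambda>x. a * v x + b * w x) = (\<lambda>x. a * T v x + b * T w x)" for a b v w
    proof -
      have "T (s1 a v + s1 b w) = s2 a (T v) + s2 b (T w)"
        by (simp only: T.add T.scale)
      then show ?thesis
        by (simp only: s1_def s2_def plus_fun_def)
    qed
    show "R w (T w)" if "R w g" for w g
      using RT B(3) that by blast
    show "\<exists>v. R v (T w)" for w
      using rng T(3) by blast
  qed
qed

lemma trace_operator_exists:
  assumes "open \<Omega>"
  shows "\<exists>T. trace_operator \<Omega> T"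
proof (cases "\<exists>v g. has_trace \<Omega> v g")
  case True
  then obtain v0 g0 where vg: "has_trace \<Omega> v0 g0" by blast
  show ?thesis
  proof (rule linear_selection[of "has_trace \<Omega>", OF vg has_trace_lincomb[OF assms]])
    fix T assume T: "\<And>a b v w. T (\<lambda>x. a * v x + b * w x) = (\<lambda>x. a * T v x + b * T w x)"
      "\<And>w g. has_trace \<Omega> w g \<Longrightarrow> has_trace \<Omega> w (T w)" "\<And>w. \<exists>v. has_trace \<Omega> v (T w)"
    have "T w \<in> L2 (surface_measure (frontier \<Omega>))" for w
      using T(3)[of w] unfolding has_trace_def by (elim exE conjE)
    then have "trace_operator \<Omega> T"
      unfolding trace_operator_def
    proof (intro conjI ballI allI impI AE_I2)
      show "T (\<lambda>y. a * v y + b * w y) x = a * T v x + b * T w x" for a b v w x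
        by (simp only: T(1))
      show "has_trace \<Omega> w (T w)" if "\<exists>g. has_trace \<Omega> w g" for w
        using T(2) that by (elim exE)
    qed
    then show ?thesis by blast
  qed
next
  case False
  \<comment> \<open>If no function has a trace, agreement with \<open>has_trace\<close> is vacuous
    and the zero operator meets the other two demands.\<close>
  then show ?thesis
    by (intro exI[of _ "\<lambda>w x. 0"]) (auto simp: trace_operator_def L2_def)
qed

lemma boundary_trace_operator: "open \<Omega> \<Longrightarrow> trace_operator \<Omega> (boundary_trace \<Omega>)"
  unfolding boundary_trace_def by (rule someI_ex[OF trace_operator_exists])

lemma boundary_trace_L2:
  assumes "open \<Omega>" "w \<in> H1 \<Omega>"
  shows "boundary_trace \<Omega> w \<in> L2 (surface_measure (frontier \<Omega>))"
  using boundary_trace_operator[OF assms(1)] assms(2) unfolding trace_operator_def by blast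

lemma boundary_trace_lincomb:
  assumes "open \<Omega>" "v \<in> H1 \<Omega>" "w \<in> H1 \<Omega>"
  shows "AE x in surface_measure (frontier \<Omega>).
    boundary_trace \<Omega> (\<lambda>y. a * v y + b * w y) x = a * boundary_trace \<Omega> v x + b * boundary_trace \<Omega> w x"
  using boundary_trace_operator[OF assms(1)] assms(2,3) unfolding trace_operator_def by blast

text \<open>The surface may contain only part of its edge, so it need be neither open nor closed.
  Measurability is obtained chart by chart, and the Lindelof property leaves countably many charts
  to glue.\<close>

lemma lipschitz_surface_borel:
  fixes S :: "(real^'n) set"
  assumes "lipschitz_surface S"
  shows "S \<in> sets borel"
proof -
  \<comment> \<open>Locally, \<open>S\<close> is a Lipschitz image of a \<open>\<sigma>\<close>-compact set.\<close>
  have loc: "\<exists>U. open U \<and> x \<in> U \<and> S \<inter> U \<in> sets borel" if "x \<in> S" for x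
  proof -
    obtain U V and h :: "real^'n \<Rightarrow> real^'n" and e e' L where U: "open U" "x \<in> U"
      and V: "openin (top_of_set {y. y \<bullet> e = 0 \<and> 0 \<le> y \<bullet> e'}) V" and h: "bij_betw h V (S \<inter> U)" and "L > 0"
      and L: "\<forall>y\<in>V. \<forall>z\<in>V. dist y z / L \<le> dist (h y) (h z) \<and> dist (h y) (h z) \<le> L * dist y z"
      using bspec[OF assms[unfolded lipschitz_surface_def] \<open>x \<in> S\<close>] by (elim exE conjE)
    have "L-lipschitz_on V h"
      using L \<open>L > 0\<close> by (intro lipschitz_onI) auto
    then have cont: "continuous_on V h"
      by (rule lipschitz_on_continuous_on)
    have "closed {y. y \<bullet> e = 0 \<and> 0 \<le> y \<bullet> e'}"
      by (intro closed_Collect_conj closed_Collect_eq closed_Collect_le continuous_intros)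
    moreover obtain W where W: "open W" "V = {y. y \<bullet> e = 0 \<and> 0 \<le> y \<bullet> e'} \<inter> W"
      using V by (auto simp: openin_open)
    moreover obtain C :: "nat \<Rightarrow> (real^'n) set" where C: "\<And>n. compact (C n)" "W = (\<Union>n. C n)"
      by (rule open_Union_compact_subsets[OF W(1)]) (erule (1) that[OF _ sym])
    ultimately have cpt: "compact ({y. y \<bullet> e = 0 \<and> 0 \<le> y \<bullet> e'} \<inter> C n)" for n
      by (intro closed_Int_compact)
    have "S \<inter> U = h ` V"
      using h by (simp add: bij_betw_def)
    also have "\<dots> = (\<Union>n. h ` ({y. y \<bullet> e = 0 \<and> 0 \<le> y \<bullet> e'} \<inter> C n))"
      unfolding W(2) C(2) by blast
    also have "\<dots> \<in> sets borel"
    proof (intro sets.countable_UN image_subsetI)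
      fix n
      have "{y. y \<bullet> e = 0 \<and> 0 \<le> y \<bullet> e'} \<inter> C n \<subseteq> V"
        unfolding W(2) C(2) by blast
      then have "compact (h ` ({y. y \<bullet> e = 0 \<and> 0 \<le> y \<bullet> e'} \<inter> C n))"
        by (intro compact_continuous_image cpt continuous_on_subset[OF cont])
      then show "h ` ({y. y \<bullet> e = 0 \<and> 0 \<le> y \<bullet> e'} \<inter> C n) \<in> sets borel"
        by (rule borel_compact)
    qed
    finally show ?thesis using U by blast
  qed
  define \<F> where "\<F> = {U. open U \<and> S \<inter> U \<in> sets borel}"
  obtain \<F>' where F': "\<F>' \<subseteq> \<F>" "countable \<F>'" "\<Union>\<F>' = \<Union>\<F>"
    by (rule Lindelof[of \<F>]) (auto simp: \<F>_def)
  have "S = (\<Union>U\<in>\<F>'. S \<inter> U)"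
  proof
    show "S \<subseteq> (\<Union>U\<in>\<F>'. S \<inter> U)"
    proof
      fix x assume "x \<in> S"
      with loc have "x \<in> \<Union>\<F>" by (auto simp: \<F>_def)
      then show "x \<in> (\<Union>U\<in>\<F>'. S \<inter> U)"
        using \<open>x \<in> S\<close> unfolding F'(3)[symmetric] by blast
    qed
  qed blast
  also have "\<dots> \<in> sets borel"
    using F' by (intro sets.countable_UN') (auto simp: \<F>_def)
  finally show ?thesis .
qed

lemma borel_openin_frontier:
  assumes "openin (top_of_set (frontier \<Omega>)) S"
  shows "S \<in> sets borel"
proof -
  from assms obtain W where "open W" "S = frontier \<Omega> \<inter> W"
    by (auto simp: openin_open)
  then show ?thesis by (simp add: sets.Int borel_closed)
qed

section \<open>Vector fields\<close>

lemma linear_axis: "linear (axis k :: 'b::real_vector \<Rightarrow> 'b^'n)"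
  by (rule linearI) (simp_all add: vec_eq_iff axis_def)

text \<open>The entry type is left general so that the equivalence applies once to vector fields and
  twice to matrix fields such as \<open>strain\<close>. Backwards, the field is rebuilt as the sum
  of its components placed on the axes.\<close>

lemma L2_vec_iff:
  fixes f :: "'a \<Rightarrow> 'b::euclidean_space^'n"
  shows "f \<in> L2 M \<longleftrightarrow> (\<forall>k. (\<lambda>x. f x $ k) \<in> L2 M)"
proof
  assume f: "f \<in> L2 M"
  show "\<forall>k. (\<lambda>x. f x $ k) \<in> L2 M"
  proof
    fix k
    have meas: "(\<lambda>x. f x $ k) \<in> borel_measurable M"
    proof (rule measurable_compose[where N = borel and f = f and g = "\<lambda>v. v $ k"])
      show "f \<in> borel_measurable M" using f by (simp add: L2_def)
      show "(\<lambda>v. v $ k) \<in> borel_measurable (borel :: ('b^'n) measure)"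
        by (intro borel_measurable_continuous_onI continuous_intros)
    qed
    have "integrable M (\<lambda>x. (norm (f x $ k))\<^sup>2)"
    proof (rule Bochner_Integration.integrable_bound)
      show "integrable M (\<lambda>x. (norm (f x))\<^sup>2)"
        using f by (simp add: L2_def)
      have "(norm (f x $ k))\<^sup>2 \<le> (norm (f x))\<^sup>2" for x
        by (rule power_mono[OF Finite_Cartesian_Product.norm_nth_le norm_ge_zero])
      then show "AE x in M. norm ((norm (f x $ k))\<^sup>2) \<le> norm ((norm (f x))\<^sup>2)"
        by simp
    qed (use meas in simp)
    with meas show "(\<lambda>x. f x $ k) \<in> L2 M" by (simp add: L2_def)
  qed
next
  assume comp: "\<forall>k. (\<lambda>x. f x $ k) \<in> L2 M"
  have "(\<lambda>x. axis k (f x $ k) :: 'b^'n) \<in> L2 M" for k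
  proof -
    have "continuous_on UNIV (axis k :: 'b \<Rightarrow> 'b^'n)"
      by (intro linear_continuous_on linear_conv_bounded_linear[THEN iffD1] linear_axis)
    then have "(axis k :: 'b \<Rightarrow> 'b^'n) \<in> borel_measurable borel"
      by (rule borel_measurable_continuous_onI)
    moreover have "(\<lambda>x. f x $ k) \<in> borel_measurable M" "integrable M (\<lambda>x. (norm (f x $ k))\<^sup>2)"
      using comp by (simp_all add: L2_def)
    moreover have "norm (axis k v :: 'b^'n) = norm v" for v :: 'b
      by (simp add: norm_eq_sqrt_inner inner_axis_axis)
    ultimately show ?thesis
      using measurable_compose[of "\<lambda>x. f x $ k" M borel "axis k" borel] by (simp add: L2_def)
  qed
  then have "(\<lambda>x. \<Sum>k\<in>UNIV. axis k (f x $ k)) \<in> L2 M"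
    by (intro L2_sum)
  moreover have "(\<Sum>k\<in>UNIV. axis k (f x $ k)) = f x" for x
    unfolding vec_eq_iff by (simp add: axis_def)
  ultimately show "f \<in> L2 M" by simp
qed

lemma H1_vec_lincomb:
  assumes "open \<Omega>" "u \<in> H1_vec \<Omega>" "v \<in> H1_vec \<Omega>"
  shows "(\<lambda>x. a *\<^sub>R u x + b *\<^sub>R v x) \<in> H1_vec \<Omega>"
  using assms by (simp add: H1_vec_def H1_lincomb)

lemma trace_vec_L2:
  assumes "open \<Omega>" "u \<in> H1_vec \<Omega>"
  shows "trace_vec \<Omega> u \<in> L2 (surface_measure (frontier \<Omega>))"
  using boundary_trace_L2[OF assms(1)] assms(2) by (simp add: L2_vec_iff trace_vec_def H1_vec_def)

lemma AE_all_finite: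
  fixes P :: "'i::finite \<Rightarrow> 'a \<Rightarrow> bool"
  assumes "\<And>i. AE x in M. P i x"
  shows "AE x in M. \<forall>i. P i x"
  using AE_finite_allI[where S = UNIV and M = M and Q = P] assms by simp

lemma trace_vec_lincomb:
  assumes "open \<Omega>" "u \<in> H1_vec \<Omega>" "v \<in> H1_vec \<Omega>"
  shows "AE x in surface_measure (frontier \<Omega>).
    trace_vec \<Omega> (\<lambda>x. a *\<^sub>R u x + b *\<^sub>R v x) x = a *\<^sub>R trace_vec \<Omega> u x + b *\<^sub>R trace_vec \<Omega> v x"
proof -
  have "AE x in surface_measure (frontier \<Omega>). \<forall>k.
    boundary_trace \<Omega> (\<lambda>y. a * u y $ k + b * v y $ k) x =
      a * boundary_trace \<Omega> (\<lambda>y. u y $ k) x + b * boundary_trace \<Omega> (\<lambda>y. v y $ k) x"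
    using assms by (intro AE_all_finite boundary_trace_lincomb) (simp_all add: H1_vec_def)
  then show ?thesis
    by eventually_elim (simp add: trace_vec_def vec_eq_iff)
qed

lemma strain_L2:
  assumes "u \<in> H1_vec \<Omega>"
  shows "strain \<Omega> u \<in> L2 (lebesgue_on \<Omega>)"
proof -
  have "(\<lambda>x. (1 / 2) * (weak_partial \<Omega> k (\<lambda>y. u y $ l) x + weak_partial \<Omega> l (\<lambda>y. u y $ k) x)) \<in> L2 (lebesgue_on \<Omega>)" for k l
    using assms by (intro L2_cmult L2_add weak_partial_has_weak_partial(1)) (simp_all add: H1_vec_def)
  then show ?thesis
    by (simp add: L2_vec_iff strain_def)
qed

lemma strain_lincomb:
  assumes "open \<Omega>" "u \<in> H1_vec \<Omega>" "v \<in> H1_vec \<Omega>"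
  shows "AE x in lebesgue_on \<Omega>.
    strain \<Omega> (\<lambda>x. a *\<^sub>R u x + b *\<^sub>R v x) x = a *\<^sub>R strain \<Omega> u x + b *\<^sub>R strain \<Omega> v x"
proof -
  have "AE x in lebesgue_on \<Omega>. \<forall>k l.
    weak_partial \<Omega> k (\<lambda>y. a * u y $ l + b * v y $ l) x =
      a * weak_partial \<Omega> k (\<lambda>y. u y $ l) x + b * weak_partial \<Omega> k (\<lambda>y. v y $ l) x"
    using assms by (intro AE_all_finite weak_partial_lincomb) (simp_all add: H1_vec_def)
  then show ?thesis
    by eventually_elim (simp add: strain_def vec_eq_iff field_simps)
qed

text \<open>Ellipticity of the tensor is assumed on symmetric matrices only.\<close>

lemma strain_symmetric: "transpose (strain \<Omega> u x) = strain \<Omega> u x"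
  by (simp add: transpose_def strain_def add.commute)

lemma V0_lincomb:
  assumes "open \<Omega>" "D \<in> sets borel" "u \<in> V0 D \<Omega>" "v \<in> V0 D \<Omega>"
  shows "(\<lambda>x. a *\<^sub>R u x + b *\<^sub>R v x) \<in> V0 D \<Omega>"
proof -
  have uv: "u \<in> H1_vec \<Omega>" "v \<in> H1_vec \<Omega>"
    "AE x in surface_measure (D \<inter> frontier \<Omega>). trace_vec \<Omega> u x = 0"
    "AE x in surface_measure (D \<inter> frontier \<Omega>). trace_vec \<Omega> v x = 0"
    using assms by (auto simp: V0_def)
  have "frontier \<Omega> \<in> sets borel" by (simp add: borel_closed)
  with AE_surface_measure_mono[OF _ _ _ trace_vec_lincomb[OF assms(1) uv(1,2)], of "D \<inter> frontier \<Omega>"] assms(2)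
  have "AE x in surface_measure (D \<inter> frontier \<Omega>).
      trace_vec \<Omega> (\<lambda>x. a *\<^sub>R u x + b *\<^sub>R v x) x = a *\<^sub>R trace_vec \<Omega> u x + b *\<^sub>R trace_vec \<Omega> v x"
    by (simp add: sets.Int)
  with uv(3,4) have "AE x in surface_measure (D \<inter> frontier \<Omega>).
      trace_vec \<Omega> (\<lambda>x. a *\<^sub>R u x + b *\<^sub>R v x) x = 0"
    by eventually_elim simp
  with H1_vec_lincomb[OF assms(1) uv(1,2)] show ?thesis
    by (simp add: V0_def)
qed

lemma V_affine_H1_vec:
  assumes "open \<Omega>" "g \<in> H1_vec \<Omega>" "u \<in> V_affine D \<Omega> g"
  shows "u \<in> H1_vec \<Omega>"
proof -
  obtain v where "v \<in> V0 D \<Omega>" "u = (\<lambda>x. v x + g x)"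
    using assms(3) by (auto simp: V_affine_def)
  then show ?thesis
    using H1_vec_lincomb[OF assms(1) _ assms(2), of v 1 1] by (simp add: V0_def)
qed

text \<open>The boundary datum \<open>g\<close> cancels, which makes the step from one admissible
  field to another a legitimate test function.\<close>

lemma V_affine_diff:
  assumes "open \<Omega>" "D \<in> sets borel" "u \<in> V_affine D \<Omega> g" "w \<in> V_affine D \<Omega> g"
  shows "(\<lambda>x. w x - u x) \<in> V0 D \<Omega>"
proof -
  obtain v v' where v: "v \<in> V0 D \<Omega>" "u = (\<lambda>x. v x + g x)" "v' \<in> V0 D \<Omega>" "w = (\<lambda>x. v' x + g x)"
    using assms(3,4) by (auto simp: V_affine_def)
  then show ?thesis
    using V0_lincomb[OF assms(1,2) v(3) v(1), of 1 "-1"] by simp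
qed

section \<open>The forms and the energy\<close>

lemma lebesgue_on_subset:
  assumes "open \<Omega>" "open U" "U \<subseteq> \<Omega>"
  shows "lebesgue_on U = restrict_space (lebesgue_on \<Omega>) U"
    and "U \<inter> space (lebesgue_on \<Omega>) \<in> sets (lebesgue_on \<Omega>)"
proof -
  have s: "\<Omega> \<inter> space lebesgue \<in> sets lebesgue" "U \<inter> space lebesgue \<in> sets lebesgue"
    using assms(1,2) by simp_all
  show "lebesgue_on U = restrict_space (lebesgue_on \<Omega>) U"
    unfolding restrict_restrict_space[OF s] Int_absorb1[OF assms(3)] ..
  show "U \<inter> space (lebesgue_on \<Omega>) \<in> sets (lebesgue_on \<Omega>)"
    using s assms(3) by (auto simp: sets_restrict_space intro!: image_eqI[of _ _ U])
qed

lemma AE_lebesgue_on_subset: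
  assumes "open \<Omega>" "open U" "U \<subseteq> \<Omega>" "AE x in lebesgue_on \<Omega>. P x"
  shows "AE x in lebesgue_on U. P x"
proof -
  note U = lebesgue_on_subset[OF assms(1-3)]
  have "AE x in lebesgue_on \<Omega>. x \<in> U \<longrightarrow> P x"
    using assms(4) by (rule AE_mp) (rule AE_I2, blast)
  then have "AE x in restrict_space (lebesgue_on \<Omega>) U. P x"
    by (rule AE_restrict_space_iff[OF U(2), THEN iffD2])
  then show ?thesis by (subst U(1))
qed

text \<open>The tensor is given on \<Omega>, while each half step takes place on one
  subdomain.\<close>

lemma elasticity_tensor_subset:
  assumes "elasticity_tensor \<Omega> c" "open \<Omega>" "open U" "U \<subseteq> \<Omega>"
  shows "elasticity_tensor U c"
proof -
  note AE_U = AE_lebesgue_on_subset[OF assms(2-4)]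
  obtain c0 where c0: "c0 > 0" "AE x in lebesgue_on \<Omega>. \<forall>\<xi>. transpose \<xi> = \<xi> \<longrightarrow> tensor_app c x \<xi> \<bullet> \<xi> \<ge> c0 * (norm \<xi>)\<^sup>2"
    and bdd: "\<And>k l m n. c k l m n \<in> Linf (lebesgue_on \<Omega>)"
    and sym: "\<And>k l m n. AE x in lebesgue_on \<Omega>. c k l m n x = c m n k l x \<and> c k l m n x = c l k m n x"
    using assms(1) unfolding elasticity_tensor_def by blast
  have "c k l m n \<in> Linf (lebesgue_on U)" for k l m n
  proof -
    obtain B where meas: "c k l m n \<in> borel_measurable (lebesgue_on \<Omega>)" and B: "AE x in lebesgue_on \<Omega>. \<bar>c k l m n x\<bar> \<le> B"
      using bdd[of k l m n] unfolding Linf_def by blast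
    have "c k l m n \<in> borel_measurable (lebesgue_on U)"
      unfolding lebesgue_on_subset(1)[OF assms(2-4)] by (rule measurable_restrict_space1[OF meas])
    with AE_U[OF B] show ?thesis unfolding Linf_def by blast
  qed
  then show ?thesis
    unfolding elasticity_tensor_def
    by (intro conjI allI exI[of _ c0] AE_U[OF sym] AE_U[OF c0(2)] c0(1))
qed

section \<open>The bulk form as a nonnegative quadratic form\<close>

lemma tensor_app_lincomb:
  "tensor_app c x (a *\<^sub>R \<xi> + b *\<^sub>R \<eta>) = a *\<^sub>R tensor_app c x \<xi> + b *\<^sub>R tensor_app c x \<eta>"
  by (simp add: tensor_app_def vec_eq_iff algebra_simps sum.distrib sum_distrib_left)

lemma tensor_app_symmetric:
  assumes "\<And>k l m n. c k l m n x = c m n k l x"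
  shows "tensor_app c x \<xi> \<bullet> \<eta> = tensor_app c x \<eta> \<bullet> \<xi>"
proof -
  have exp: "tensor_app c x \<xi> \<bullet> \<eta> = (\<Sum>k\<in>UNIV. \<Sum>l\<in>UNIV. \<Sum>m\<in>UNIV. \<Sum>n\<in>UNIV. c k l m n x * \<xi> $ m $ n * \<eta> $ k $ l)" for \<xi> \<eta>
    by (simp add: tensor_app_def inner_vec_def sum_distrib_right)
  have eq: "c k l m n x * \<xi> $ m $ n * \<eta> $ k $ l = c m n k l x * \<eta> $ k $ l * \<xi> $ m $ n" for k l m n
    unfolding assms[of k l m n] by (simp only: mult_ac)
  \<comment> \<open>With the four indices grouped into two pairs, the major symmetry of the tensor
    amounts to a single exchange of summation order.\<close>
  have pair: "(\<Sum>(k, l)\<in>UNIV. h k l) = (\<Sum>k\<in>UNIV. \<Sum>l\<in>UNIV. h k l)" for h :: "'a \<Rightarrow> 'a \<Rightarrow> real"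
    by (simp add: sum.cartesian_product)
  have "tensor_app c x \<xi> \<bullet> \<eta> = (\<Sum>(k, l)\<in>UNIV. \<Sum>(m, n)\<in>UNIV. c k l m n x * \<xi> $ m $ n * \<eta> $ k $ l)"
    unfolding exp pair ..
  also have "\<dots> = (\<Sum>(m, n)\<in>UNIV. \<Sum>(k, l)\<in>UNIV. c k l m n x * \<xi> $ m $ n * \<eta> $ k $ l)"
    unfolding case_prod_beta by (rule sum.swap)
  also have "\<dots> = (\<Sum>(m, n)\<in>UNIV. \<Sum>(k, l)\<in>UNIV. c m n k l x * \<eta> $ k $ l * \<xi> $ m $ n)"
    by (simp only: eq)
  also have "\<dots> = tensor_app c x \<eta> \<bullet> \<xi>"
    unfolding exp pair ..
  finally show ?thesis .
qed

lemma stress_L2: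
  assumes "elasticity_tensor \<Omega> c" "u \<in> H1_vec \<Omega>"
  shows "stress c \<Omega> u \<in> L2 (lebesgue_on \<Omega>)"
proof -
  have "\<And>k l. (\<lambda>x. strain \<Omega> u x $ k $ l) \<in> L2 (lebesgue_on \<Omega>)"
    using strain_L2[OF assms(2)] by (simp add: L2_vec_iff)
  moreover have "\<And>k l m n. c k l m n \<in> Linf (lebesgue_on \<Omega>)"
    using assms(1) unfolding elasticity_tensor_def by blast
  ultimately have "(\<lambda>x. c k l m n x *\<^sub>R strain \<Omega> u x $ m $ n) \<in> L2 (lebesgue_on \<Omega>)" for k l m n
    by (intro Linf_mult_L2)
  then have "(\<lambda>x. \<Sum>m\<in>UNIV. \<Sum>n\<in>UNIV. c k l m n x *\<^sub>R strain \<Omega> u x $ m $ n) \<in> L2 (lebesgue_on \<Omega>)" for k l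
    by (intro L2_sum)
  then show ?thesis
    by (simp add: L2_vec_iff stress_def tensor_app_def)
qed

text \<open>The two mixed terms coincide because the tensor is symmetric under exchange of its index
  pairs; hence the factor 2.\<close>

lemma bulk_form_add_square:
  assumes c: "elasticity_tensor \<Omega> c" and "open \<Omega>" and u: "u \<in> H1_vec \<Omega>" and v: "v \<in> H1_vec \<Omega>"
  shows "bulk_form c \<Omega> (\<lambda>x. u x + v x) (\<lambda>x. u x + v x) =
    bulk_form c \<Omega> u u + 2 * bulk_form c \<Omega> u v + bulk_form c \<Omega> v v"
proof -
  have uv: "(\<lambda>x. u x + v x) \<in> H1_vec \<Omega>"
    using H1_vec_lincomb[OF \<open>open \<Omega>\<close> u v, of 1 1] by simp
  have int: "integrable (lebesgue_on \<Omega>) (\<lambda>x. stress c \<Omega> p x \<bullet> strain \<Omega> r x)"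
    if "p \<in> H1_vec \<Omega>" "r \<in> H1_vec \<Omega>" for p r
    by (rule L2_inner_integrable[OF stress_L2[OF c that(1)] strain_L2[OF that(2)]])
  have "AE x in lebesgue_on \<Omega>. \<forall>k l m n. c k l m n x = c m n k l x"
  proof (intro AE_all_finite)
    show "AE x in lebesgue_on \<Omega>. c k l m n x = c m n k l x" for k l m n
      using c[unfolded elasticity_tensor_def, THEN conjunct2, THEN conjunct1, THEN spec, THEN spec, THEN spec, THEN spec, of k l m n]
      by (rule AE_mp) (rule AE_I2, blast)
  qed
  moreover have "AE x in lebesgue_on \<Omega>. strain \<Omega> (\<lambda>x. u x + v x) x = strain \<Omega> u x + strain \<Omega> v x"
    using strain_lincomb[OF \<open>open \<Omega>\<close> u v, of 1 1] by simp
  ultimately have "AE x in lebesgue_on \<Omega>.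
      stress c \<Omega> (\<lambda>x. u x + v x) x \<bullet> strain \<Omega> (\<lambda>x. u x + v x) x =
      stress c \<Omega> u x \<bullet> strain \<Omega> u x + 2 * (stress c \<Omega> u x \<bullet> strain \<Omega> v x) + stress c \<Omega> v x \<bullet> strain \<Omega> v x"
  proof eventually_elim
    case (elim x)
    have "tensor_app c x (strain \<Omega> u x) \<bullet> strain \<Omega> v x = tensor_app c x (strain \<Omega> v x) \<bullet> strain \<Omega> u x"
      by (rule tensor_app_symmetric) (use elim(1) in blast)
    with elim(2) tensor_app_lincomb[of c x 1 "strain \<Omega> u x" 1 "strain \<Omega> v x"] show ?case
      by (simp add: stress_def inner_add_left inner_add_right)
  qed
  then have "bulk_form c \<Omega> (\<lambda>x. u x + v x) (\<lambda>x. u x + v x) =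
      (LINT x|lebesgue_on \<Omega>. stress c \<Omega> u x \<bullet> strain \<Omega> u x + 2 * (stress c \<Omega> u x \<bullet> strain \<Omega> v x) + stress c \<Omega> v x \<bullet> strain \<Omega> v x)"
    unfolding bulk_form_def using int[OF uv uv] int[OF u u] int[OF u v] int[OF v v]
    by (intro integral_cong_AE) auto
  also have "\<dots> = bulk_form c \<Omega> u u + 2 * bulk_form c \<Omega> u v + bulk_form c \<Omega> v v"
    unfolding bulk_form_def using int[OF u u] int[OF u v] int[OF v v] by simp
  finally show ?thesis .
qed

lemma bulk_form_nonneg:
  assumes "elasticity_tensor \<Omega> c"
  shows "bulk_form c \<Omega> v v \<ge> 0"
proof -
  obtain c0 where c0: "c0 > 0" "AE x in lebesgue_on \<Omega>. \<forall>\<xi>. transpose \<xi> = \<xi> \<longrightarrow> tensor_app c x \<xi> \<bullet> \<xi> \<ge> c0 * (norm \<xi>)\<^sup>2"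
    using assms unfolding elasticity_tensor_def by blast
  from c0(2) have "AE x in lebesgue_on \<Omega>. 0 \<le> stress c \<Omega> v x \<bullet> strain \<Omega> v x"
  proof eventually_elim
    case (elim x)
    have "0 \<le> c0 * (norm (strain \<Omega> v x))\<^sup>2" using c0(1) by simp
    also have "\<dots> \<le> stress c \<Omega> v x \<bullet> strain \<Omega> v x"
      using elim strain_symmetric[of \<Omega> v x] unfolding stress_def by blast
    finally show ?case .
  qed
  then show ?thesis
    unfolding bulk_form_def by (rule integral_nonneg_AE)
qed

lemma interface_form_diff_square:
  assumes \<zeta>: "\<zeta> \<in> Linf (surface_measure \<Gamma>)" "AE x in surface_measure \<Gamma>. \<zeta> x \<ge> 0"
    and L2: "p \<in> L2 (surface_measure \<Gamma>)" "t \<in> L2 (surface_measure \<Gamma>)" "s \<in> L2 (surface_measure \<Gamma>)" "r \<in> L2 (surface_measure \<Gamma>)"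
    and r: "AE x in surface_measure \<Gamma>. r x = t x + s x"
  shows "interface_form \<zeta> \<Gamma> (\<lambda>x. p x - r x) (\<lambda>x. p x - r x) \<ge>
    interface_form \<zeta> \<Gamma> (\<lambda>x. p x - t x) (\<lambda>x. p x - t x) + 2 * (interface_form \<zeta> \<Gamma> t s - interface_form \<zeta> \<Gamma> p s)"
proof -
  let ?M = "surface_measure \<Gamma>"
  have int: "integrable ?M (\<lambda>x. \<zeta> x * (f x \<bullet> g x))" if "f \<in> L2 ?M" "g \<in> L2 ?M" for f g
    using L2_inner_integrable[OF Linf_mult_L2[OF \<zeta>(1) that(1)] that(2)] by simp
  note i = int[OF L2_diff[OF L2(1) L2(2)] L2_diff[OF L2(1) L2(2)]] int[OF L2(2,3)] int[OF L2(1,3)]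
  have "interface_form \<zeta> \<Gamma> (\<lambda>x. p x - t x) (\<lambda>x. p x - t x) + 2 * (interface_form \<zeta> \<Gamma> t s - interface_form \<zeta> \<Gamma> p s)
    = (LINT x|?M. \<zeta> x * ((p x - t x) \<bullet> (p x - t x)) + 2 * (\<zeta> x * (t x \<bullet> s x) - \<zeta> x * (p x \<bullet> s x)))"
    unfolding interface_form_def using i by simp
  also have "\<dots> \<le> (LINT x|?M. \<zeta> x * ((p x - r x) \<bullet> (p x - r x)))"
  proof (rule integral_mono_AE)
    show "integrable ?M (\<lambda>x. \<zeta> x * ((p x - t x) \<bullet> (p x - t x)) + 2 * (\<zeta> x * (t x \<bullet> s x) - \<zeta> x * (p x \<bullet> s x)))"
      using i by simp
    show "integrable ?M (\<lambda>x. \<zeta> x * ((p x - r x) \<bullet> (p x - r x)))"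
      by (rule int[OF L2_diff[OF L2(1,4)] L2_diff[OF L2(1,4)]])
    show "AE x in ?M. \<zeta> x * ((p x - t x) \<bullet> (p x - t x)) + 2 * (\<zeta> x * (t x \<bullet> s x) - \<zeta> x * (p x \<bullet> s x))
        \<le> \<zeta> x * ((p x - r x) \<bullet> (p x - r x))"
      using \<zeta>(2) r
    proof eventually_elim
      case (elim x)
      have "\<zeta> x * ((p x - r x) \<bullet> (p x - r x)) =
          \<zeta> x * ((p x - t x) \<bullet> (p x - t x)) + 2 * (\<zeta> x * (t x \<bullet> s x) - \<zeta> x * (p x \<bullet> s x)) + \<zeta> x * (s x \<bullet> s x)"
        unfolding elim(2) by (simp add: inner_diff_left inner_diff_right inner_add_left inner_add_right inner_commute algebra_simps)
      then show ?case using elim(1) by simp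
    qed
  qed
  finally show ?thesis unfolding interface_form_def .
qed

text \<open>For the surface load, \<open>q\<close> is restricted from \<open>N\<close> and the trace
  from the frontier to their intersection, where both are square integrable and the integral
  splits.\<close>

lemma load_form_add:
  assumes "open \<Omega>" "N \<in> sets borel" and f: "f \<in> L2 (lebesgue_on \<Omega>)" and q: "q \<in> L2 (surface_measure N)"
    and u: "u \<in> H1_vec \<Omega>" and v: "v \<in> H1_vec \<Omega>"
  shows "load_form f q N \<Omega> (\<lambda>x. u x + v x) = load_form f q N \<Omega> u + load_form f q N \<Omega> v"
proof -
  let ?M = "surface_measure (N \<inter> frontier \<Omega>)"
  have uv: "(\<lambda>x. u x + v x) \<in> H1_vec \<Omega>"
    using H1_vec_lincomb[OF \<open>open \<Omega>\<close> u v, of 1 1] by simp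
  have fr: "frontier \<Omega> \<in> sets borel" by (simp add: borel_closed)
  have N': "N \<inter> frontier \<Omega> \<in> sets borel" using assms(2) fr by (rule sets.Int)
  have q': "q \<in> L2 ?M"
    by (rule L2_surface_measure_mono[OF assms(2) N' _ q]) simp
  have tr: "trace_vec \<Omega> w \<in> L2 ?M" if "w \<in> H1_vec \<Omega>" for w
    by (rule L2_surface_measure_mono[OF fr N' _ trace_vec_L2[OF \<open>open \<Omega>\<close> that]]) simp
  have L2u: "w \<in> L2 (lebesgue_on \<Omega>)" if "w \<in> H1_vec \<Omega>" for w
    using that H1_L2 unfolding L2_vec_iff H1_vec_def by blast
  have iq: "integrable ?M (\<lambda>x. q x \<bullet> trace_vec \<Omega> w x)" if "w \<in> H1_vec \<Omega>" for w
    by (rule L2_inner_integrable[OF q' tr[OF that]])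
  have "AE x in ?M. trace_vec \<Omega> (\<lambda>x. u x + v x) x = trace_vec \<Omega> u x + trace_vec \<Omega> v x"
    using AE_surface_measure_mono[OF fr N' _ trace_vec_lincomb[OF \<open>open \<Omega>\<close> u v, of 1 1]] by simp
  then have "AE x in ?M. q x \<bullet> trace_vec \<Omega> (\<lambda>x. u x + v x) x = q x \<bullet> trace_vec \<Omega> u x + q x \<bullet> trace_vec \<Omega> v x"
    by eventually_elim (simp add: inner_add_right)
  then have "(LINT x|?M. q x \<bullet> trace_vec \<Omega> (\<lambda>x. u x + v x) x) = (LINT x|?M. q x \<bullet> trace_vec \<Omega> u x + q x \<bullet> trace_vec \<Omega> v x)"
    using iq[OF uv] iq[OF u] iq[OF v] by (intro integral_cong_AE) auto
  then show ?thesis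
    unfolding load_form_def using iq[OF u] iq[OF v] L2_inner_integrable[OF f L2u[OF u]] L2_inner_integrable[OF f L2u[OF v]]
    by (simp add: inner_add_right)
qed

text \<open>\<open>J\<close> collects the terms of the energy that depend on one component when the
  trace \<open>p\<close> of the other is frozen; the equation for \<open>u\<close> says that
  \<open>J\<close> is stationary at \<open>u\<close> in the directions of \<open>V0\<close>.\<close>

lemma partial_energy_minimum:
  assumes c: "elasticity_tensor \<Omega> c" and "open \<Omega>"
    and D: "D \<in> sets borel" and N: "N \<in> sets borel" and \<Gamma>: "\<Gamma> \<in> sets borel" "\<Gamma> \<subseteq> frontier \<Omega>"
    and f: "f \<in> L2 (lebesgue_on \<Omega>)" and q: "q \<in> L2 (surface_measure N)"
    and \<zeta>: "\<zeta> \<in> Linf (surface_measure \<Gamma>)" "AE x in surface_measure \<Gamma>. \<zeta> x \<ge> 0"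
    and g: "g \<in> H1_vec \<Omega>" and u: "u \<in> V_affine D \<Omega> g" and w: "w \<in> V_affine D \<Omega> g"
    and p: "p \<in> L2 (surface_measure \<Gamma>)"
    and eq: "\<forall>v\<in>V0 D \<Omega>. bulk_form c \<Omega> u v + interface_form \<zeta> \<Gamma> (trace_vec \<Omega> u) (trace_vec \<Omega> v)
      = interface_form \<zeta> \<Gamma> p (trace_vec \<Omega> v) + load_form f q N \<Omega> v"
  defines "J \<equiv> \<lambda>w. 1 / 2 * (bulk_form c \<Omega> w w
      + interface_form \<zeta> \<Gamma> (\<lambda>x. p x - trace_vec \<Omega> w x) (\<lambda>x. p x - trace_vec \<Omega> w x)) - load_form f q N \<Omega> w"
  shows "J u \<le> J w"
proof -
  define v where "v x = w x - u x" for x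
  have v0: "v \<in> V0 D \<Omega>"
    using V_affine_diff[OF \<open>open \<Omega>\<close> D u w] by (simp add: v_def[abs_def])
  have w_eq: "w = (\<lambda>x. u x + v x)" by (simp add: v_def)
  have uH: "u \<in> H1_vec \<Omega>" and wH: "w \<in> H1_vec \<Omega>"
    using V_affine_H1_vec[OF \<open>open \<Omega>\<close> g] u w by blast+
  have vH: "v \<in> H1_vec \<Omega>" using v0 by (simp add: V0_def)
  have fr: "frontier \<Omega> \<in> sets borel" by (simp add: borel_closed)
  have tr: "trace_vec \<Omega> z \<in> L2 (surface_measure \<Gamma>)" if "z \<in> H1_vec \<Omega>" for z
    by (rule L2_surface_measure_mono[OF fr \<Gamma> trace_vec_L2[OF \<open>open \<Omega>\<close> that]])
  have tr_w: "AE x in surface_measure \<Gamma>. trace_vec \<Omega> w x = trace_vec \<Omega> u x + trace_vec \<Omega> v x"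
    using AE_surface_measure_mono[OF fr \<Gamma> trace_vec_lincomb[OF \<open>open \<Omega>\<close> uH vH, of 1 1]] by (simp add: w_eq)
  have "bulk_form c \<Omega> w w = bulk_form c \<Omega> u u + 2 * bulk_form c \<Omega> u v + bulk_form c \<Omega> v v"
    unfolding w_eq by (rule bulk_form_add_square[OF c \<open>open \<Omega>\<close> uH vH])
  moreover have "bulk_form c \<Omega> v v \<ge> 0" by (rule bulk_form_nonneg[OF c])
  moreover have "load_form f q N \<Omega> w = load_form f q N \<Omega> u + load_form f q N \<Omega> v"
    unfolding w_eq by (rule load_form_add[OF \<open>open \<Omega>\<close> N f q uH vH])
  \<comment> \<open>The factor 2 of the cross terms cancels the 1/2 in \<open>J\<close>, and what
    remains of first order in \<open>v\<close> is the residual of \<open>eq\<close>.\<close>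
  moreover note interface_form_diff_square[OF \<zeta> p tr[OF uH] tr[OF vH] tr[OF wH] tr_w] bspec[OF eq v0]
  ultimately show ?thesis
    unfolding J_def by (simp add: field_simps)
qed

theorem theorem4p1:
  fixes \<Omega> \<Omega>1 \<Omega>2 \<Gamma> D N :: "(real^'n) set"
    and c :: "'n tensor"
    and g1 g2 f q :: "real^'n \<Rightarrow> real^'n"
    and \<zeta> :: "real^'n \<Rightarrow> real"
    and u1 u2 :: "nat \<Rightarrow> real^'n \<Rightarrow> real^'n"
  assumes "CARD('n) \<in> {2, 3}"
    and "geometry \<Omega> \<Omega>1 \<Omega>2 \<Gamma> D N"
    and "elasticity_tensor \<Omega> c"
    and "(g1, g2) \<in> H1_vec \<Omega>1 \<times> H1_vec \<Omega>2"
    and "f \<in> L2 (lebesgue_on \<Omega>)"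
    and "q \<in> L2 (surface_measure N)"
    and "\<zeta> \<in> Linf (surface_measure \<Gamma>)" and "AE x in surface_measure \<Gamma>. \<zeta> x \<ge> 0"
    and "u1 0 \<in> V_affine D \<Omega>1 g1" and "u2 0 \<in> V_affine D \<Omega>2 g2"
    and "\<forall>m\<ge>1. (u1 m, u2 m) \<in> V_affine D \<Omega>1 g1 \<times> V_affine D \<Omega>2 g2"
    and "\<forall>m\<ge>1. \<forall>v1 \<in> V0 D \<Omega>1.
           bulk_form c \<Omega>1 (u1 m) v1
           + interface_form \<zeta> \<Gamma> (trace_vec \<Omega>1 (u1 m)) (trace_vec \<Omega>1 v1)
           = interface_form \<zeta> \<Gamma> (trace_vec \<Omega>2 (u2 (m - 1))) (trace_vec \<Omega>1 v1)
           + load_form f q N \<Omega>1 v1"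
    and "\<forall>m\<ge>1. \<forall>v2 \<in> V0 D \<Omega>2.
           bulk_form c \<Omega>2 (u2 m) v2
           + interface_form \<zeta> \<Gamma> (trace_vec \<Omega>2 (u2 m)) (trace_vec \<Omega>2 v2)
           = interface_form \<zeta> \<Gamma> (trace_vec \<Omega>1 (u1 m)) (trace_vec \<Omega>2 v2)
           + load_form f q N \<Omega>2 v2"
  shows "\<forall>m\<ge>1.
           energy c \<zeta> f q N \<Omega>1 \<Omega>2 \<Gamma> (u1 (m - 1), u2 (m - 1))
             \<ge> energy c \<zeta> f q N \<Omega>1 \<Omega>2 \<Gamma> (u1 m, u2 (m - 1)) \<and>
           energy c \<zeta> f q N \<Omega>1 \<Omega>2 \<Gamma> (u1 m, u2 (m - 1))
             \<ge> energy c \<zeta> f q N \<Omega>1 \<Omega>2 \<Gamma> (u1 m, u2 m)"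
proof (intro allI impI)
  fix m :: nat assume "m \<ge> 1"
  have geo: "open \<Omega>" "open \<Omega>1" "open \<Omega>2" "\<Omega>1 \<subseteq> \<Omega>" "\<Omega>2 \<subseteq> \<Omega>"
    "lipschitz_surface \<Gamma>" "\<Gamma> \<subseteq> frontier \<Omega>1" "\<Gamma> \<subseteq> frontier \<Omega>2"
    "openin (top_of_set (frontier \<Omega>)) D" "openin (top_of_set (frontier \<Omega>)) N"
    using assms(2) unfolding geometry_def lipschitz_domain_def by blast+
  have D: "D \<in> sets borel" and N: "N \<in> sets borel" and \<Gamma>: "\<Gamma> \<in> sets borel"
    by (rule borel_openin_frontier[OF geo(9)], rule borel_openin_frontier[OF geo(10)], rule lipschitz_surface_borel[OF geo(6)])
  have g: "g1 \<in> H1_vec \<Omega>1" "g2 \<in> H1_vec \<Omega>2"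
    using assms(4) by auto
  \<comment> \<open>Index 0 comes from the initial guess and every other index from the sequence;
    both occur, since \<open>m - 1\<close> is 0 in the first sweep.\<close>
  have u: "u1 k \<in> V_affine D \<Omega>1 g1" "u2 k \<in> V_affine D \<Omega>2 g2" for k
    using assms(9-11) by (cases k; auto)+
  have f: "f \<in> L2 (lebesgue_on U)" if "open U" "U \<subseteq> \<Omega>" for U
    using L2_restrict_space[OF assms(5) lebesgue_on_subset(2)[OF geo(1) that]]
    unfolding lebesgue_on_subset(1)[OF geo(1) that] .
  have tr: "trace_vec \<Omega>1 (u1 k) \<in> L2 (surface_measure \<Gamma>)" "trace_vec \<Omega>2 (u2 k) \<in> L2 (surface_measure \<Gamma>)" for k
    by (rule L2_surface_measure_mono[OF borel_closed[OF frontier_closed] \<Gamma> _ trace_vec_L2[OF _ V_affine_H1_vec[OF _ _ u(1)]]],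
        use geo g in simp_all)
       (rule L2_surface_measure_mono[OF borel_closed[OF frontier_closed] \<Gamma> _ trace_vec_L2[OF _ V_affine_H1_vec[OF _ _ u(2)]]],
        use geo g in simp_all)
  note min1 = partial_energy_minimum[OF elasticity_tensor_subset[OF assms(3) geo(1,2,4)] geo(2) D N \<Gamma> geo(7)
      f[OF geo(2,4)] assms(6-8) g(1) u(1) u(1) tr(2) spec[OF assms(12), of m, THEN mp, OF \<open>m \<ge> 1\<close>], of "m - 1"]
  note min2 = partial_energy_minimum[OF elasticity_tensor_subset[OF assms(3) geo(1,3,5)] geo(3) D N \<Gamma> geo(8)
      f[OF geo(3,5)] assms(6-8) g(2) u(2) u(2) tr(1) spec[OF assms(13), of m, THEN mp, OF \<open>m \<ge> 1\<close>], of "m - 1"]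
  have flip: "interface_form \<zeta> \<Gamma> (\<lambda>x. a x - b x) (\<lambda>x. a x - b x) = interface_form \<zeta> \<Gamma> (\<lambda>x. b x - a x) (\<lambda>x. b x - a x)" for a b
  proof -
    have "(a x - b x) \<bullet> (a x - b x) = (b x - a x) \<bullet> (b x - a x)" for x
      by (simp add: inner_diff_left inner_diff_right inner_commute)
    then show ?thesis unfolding interface_form_def by simp
  qed
  have energy: "energy c \<zeta> f q N \<Omega>1 \<Omega>2 \<Gamma> (a, b) =
      1 / 2 * (bulk_form c \<Omega>1 a a + bulk_form c \<Omega>2 b b
        + interface_form \<zeta> \<Gamma> (\<lambda>x. trace_vec \<Omega>2 b x - trace_vec \<Omega>1 a x) (\<lambda>x. trace_vec \<Omega>2 b x - trace_vec \<Omega>1 a x))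
      - (load_form f q N \<Omega>1 a + load_form f q N \<Omega>2 b)" for a b
    by (simp add: energy_def total_form_def total_load_def jump_def[abs_def])
  show "energy c \<zeta> f q N \<Omega>1 \<Omega>2 \<Gamma> (u1 m, u2 (m - 1)) \<le> energy c \<zeta> f q N \<Omega>1 \<Omega>2 \<Gamma> (u1 (m - 1), u2 (m - 1)) \<and>
      energy c \<zeta> f q N \<Omega>1 \<Omega>2 \<Gamma> (u1 m, u2 m) \<le> energy c \<zeta> f q N \<Omega>1 \<Omega>2 \<Gamma> (u1 m, u2 (m - 1))"
    unfolding energy using min1 min2
    unfolding flip[of "trace_vec \<Omega>1 (u1 m)"] by argo
qed

end
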